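(* Let $n\ge 2$ and let $X=\mathrm{IF}(1,2;E)$ be the odd symplectic partial flag manifold with $E=\mathbb{C}^{2n+1}$. For every $(a|b)\in W^{odd}$, the set $$L=\{\Gamma_{(d_1,d_2)}(X(a|b)) : (d_1,d_2)\ge(0,0)\}$$ of curve neighborhoods of the Schubert variety $X(a|b)$, partially ordered by inclusion of varieties, is a distributive lattice.
   Context: Let $n\ge 2$ and $\bar i=2n+3-i$, so that labels are ordered $1<2<\dots<n+1<\overline{n+1}<\dots<\bar 2<\bar 1$. Let $E=\mathbb{C}^{2n+1}$ with basis $e_1,\dots,e_{n+1},e_{\overline{n+1}},\dots,e_{\bar 2}$, and let $\omega$ be the skew-symmetric bilinear form on $E$ with $\omega(e_i,e_j)=\delta_{i,\bar j}$ for all $1\le i\le j\le\bar 2$; its kernel is spanned by $e_1$. The odd symplectic partial flag manifold is $$\mathrm{IF}(1,2;E)=\{V_1\subset V_2\subset E:\ \dim V_i=i,\ \omega(x,y)=0\text{ for all }x,y\in V_i\}.$$ Let $\mathrm{Sp}_{2n+1}(E)=\{g\in \mathrm{GL}(E):\omega(gu,gv)=\omega(u,v)\ \forall u,v\in E\}$ and let $B$ be its subgroup of upper triangular matrices in the basis $e_1,\dots,e_{n+1},e_{\overline{n+1}},\dots,e_{\bar 2}$ of $E$. The $B$-orbits on $\mathrm{IF}(1,2;E)$ are indexed by the set, denoted here $W^{odd}$, of pairs $(a|b)$ with $a,b\in\{1,\dots,n+1,\overline{n+1},\dots,\bar 2\}$, $a\ne b$, $a\neq \bar b$ (such a pair encodes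 a signed permutation $w$ via $w(1)=a$, $w(2)=b$). The Schubert variety $X(a|b)$ is the closure of the $B$-orbit of the flag $\langle e_a\rangle\subset\langle e_a,e_b\rangle$. A curve in $X=\mathrm{IF}(1,2;E)$ has degree $d=(d_1,d_2)$, where $d_1$ is its degree under the map $(V_1\subset V_2)\mapsto V_1\in\mathbb{P}(E)$ and $d_2$ is its degree under $(V_1\subset V_2)\mapsto V_2$ composed with the Plücker embedding (each counted as the degree of the pullback of $\mathcal{O}(1)$); this identifies effective classes in $H_2(X,\mathbb{Z})$ with $\mathbb{Z}_{\ge 0}^2$. For a closed subvariety $\Omega\subset X$ and an effective degree $d$, let $\overline{\mathcal{M}}_{0,2}(X,d)$ be the moduli space of genus $0$, degree $d$ stable maps with two marked points, with evaluation maps $\mathrm{ev}_1,\mathrm{ev}_2$ to $X$. The curve neighborhood is $\Gamma_d(\Omega)=\mathrm{ev}_2(\mathrm{ev}_1^{-1}(\Omega))\subset X$ with its reduced scheme structure; for $d=(0,0)$ the convention is $\Gamma_{(0,0)}(\Omega)=\Omega$. The notation $(d_1,d_2)\ge(0,0)$ means that $d_1,d_2$ are nonnegative integers. A lattice is a partially ordered set in which any two elements $x,y$ have a least upper bound $x\vee y$ and a greatest lower bound $x\wedge y$; it is distributive if $x\vee(y\wedge z)=(x\vee y)\wedge(x\vee z)$ for all $x,y,z$. *)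

theory Defs
  imports "HOL-Analysis.Analysis" "HOL-Algebra.Lattice"
begin

type_synonym 'm evec = "(complex, 'm) vec"
type_synonym 'm emat = "((complex, 'm) vec, 'm) vec"

text \<open>
  The space \<open>E\<close> of dimension \<open>2n+1\<close> is \<open>complex^'m\<close> with \<open>CARD('m) = 2n+1\<close>. The linearly ordered
  index type \<open>'m\<close> plays the role of the labels
  \<open>1 < 2 < ... < n+1 < bar (n+1) < ... < bar 2\<close>, and \<open>label\<close> is the resulting
  numbering by \<open>1, ..., 2n+1\<close>, for which \<open>bar i = 2n+3-i\<close>. The value \<open>bar 1 = 2n+2\<close> is not a label.
\<close>

definition label :: "'m::{finite,linorder} \<Rightarrow> nat" where
  "label i = card {..i}"

definition opposite :: "'m::{finite,linorder} \<Rightarrow> 'm \<Rightarrow> bool" where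
  "opposite i j \<longleftrightarrow> label i + label j = CARD('m) + 2"

definition basis_vec :: "'m::finite \<Rightarrow> 'm evec" where
  "basis_vec i = axis i 1"

definition omega :: "('m::{finite,linorder}) evec \<Rightarrow> 'm evec \<Rightarrow> complex" where
  "omega x y = (\<Sum>(i, j) \<in> {(i, j). i < j \<and> opposite i j}. x $ i * y $ j - x $ j * y $ i)"

definition isotropic :: "('m::{finite,linorder}) evec set \<Rightarrow> bool" where
  "isotropic V \<longleftrightarrow> (\<forall>x\<in>V. \<forall>y\<in>V. omega x y = 0)"

type_synonym 'm flag = "'m evec set \<times> 'm evec set"

definition IF12 :: "('m::{finite,linorder}) flag set" where
  "IF12 = {(V1, V2). V1 \<subseteq> V2 \<and>
     vec.subspace V1 \<and> vec.dim V1 = 1 \<and> isotropic V1 \<and>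
     vec.subspace V2 \<and> vec.dim V2 = 2 \<and> isotropic V2}"

definition W_odd :: "('m::{finite,linorder} \<times> 'm) set" where
  "W_odd = {(a, b). a \<noteq> b \<and> \<not> opposite a b}"

definition Sp :: "('m::{finite,linorder}) emat set" where
  "Sp = {g. invertible g \<and> (\<forall>u v. omega (g *v u) (g *v v) = omega u v)}"

definition Borel :: "('m::{finite,linorder}) emat set" where
  "Borel = {g \<in> Sp. \<forall>i j. j < i \<longrightarrow> g $ i $ j = 0}"

definition act :: "('m::{finite,linorder}) emat \<Rightarrow> 'm flag \<Rightarrow> 'm flag" where
  "act g F = ((*v) g ` fst F, (*v) g ` snd F)"

definition B_orbit :: "('m::{finite,linorder}) flag \<Rightarrow> 'm flag set" where
  "B_orbit F = (\<lambda>g. act g F) ` Borel"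

definition coord_flag :: "'m::{finite,linorder} \<Rightarrow> 'm \<Rightarrow> 'm flag" where
  "coord_flag a b = (vec.span {basis_vec a}, vec.span {basis_vec a, basis_vec b})"

text \<open>
  The exterior square of \<open>E\<close> is realised inside \<open>complex^('m \<times> 'm)\<close> as the antisymmetric tensors, so
  the coordinate of \<open>u \<and> v\<close> at \<open>(i, j)\<close> is the Pluecker coordinate \<open>u\<^sub>i v\<^sub>j - u\<^sub>j v\<^sub>i\<close>. Points of a
  projective space are lines, that is, one-dimensional subspaces.
\<close>

definition wedge :: "('m::finite) evec \<Rightarrow> 'm evec \<Rightarrow> ('m \<times> 'm) evec" where
  "wedge u v = (\<chi> k. u $ fst k * v $ snd k - u $ snd k * v $ fst k)"

definition pluecker :: "('m::finite) evec set \<Rightarrow> ('m \<times> 'm) evec set" where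
  "pluecker V = vec.span {wedge u v | u v. u \<in> V \<and> v \<in> V}"

text \<open>
  The Zariski topology on \<open>IF12\<close> is induced from the embedding \<open>(V1, V2) \<mapsto> (V1, pluecker V2)\<close> into a
  product of two projective spaces, whose closed sets are the zero loci of families of
  bihomogeneous polynomials.
\<close>

inductive polynomial_fun :: "(('i::finite) evec \<times> ('j::finite) evec \<Rightarrow> complex) \<Rightarrow> bool" where
  "polynomial_fun (\<lambda>_. c)"
| "polynomial_fun (\<lambda>(x, p). x $ i)"
| "polynomial_fun (\<lambda>(x, p). p $ j)"
| "polynomial_fun f \<Longrightarrow> polynomial_fun g \<Longrightarrow> polynomial_fun (\<lambda>z. f z + g z)"
| "polynomial_fun f \<Longrightarrow> polynomial_fun g \<Longrightarrow> polynomial_fun (\<lambda>z. f z * g z)"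

definition bihomogeneous :: "(('i::finite) evec \<times> ('j::finite) evec \<Rightarrow> complex) \<Rightarrow> bool" where
  "bihomogeneous f \<longleftrightarrow> polynomial_fun f \<and>
     (\<exists>k l. \<forall>s t x p. f (s *s x, t *s p) = s ^ k * t ^ l * f (x, p))"

definition zariski_closed :: "('m::{finite,linorder}) flag set \<Rightarrow> bool" where
  "zariski_closed Z \<longleftrightarrow> (\<exists>S. (\<forall>f\<in>S. bihomogeneous f) \<and>
     Z = {F \<in> IF12. \<forall>f\<in>S. \<forall>x\<in>fst F. \<forall>p\<in>pluecker (snd F). f (x, p) = 0})"

definition Schubert :: "'m::{finite,linorder} \<Rightarrow> 'm \<Rightarrow> 'm flag set" where
  "Schubert a b = zariski_closed hull B_orbit (coord_flag a b)"

definition P1 :: "(complex^2) set set" where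
  "P1 = {l. vec.subspace l \<and> vec.dim l = 1}"

text \<open>
  A morphism from \<open>P1\<close> to a projective space along which \<open>O(1)\<close> pulls back to \<open>O(d)\<close> is
  a tuple of binary forms of degree \<open>d\<close> without common zero. Here the tuple is written as one form
  with vector coefficients \<open>c 0, ..., c d\<close>.
\<close>

definition binary_form :: "nat \<Rightarrow> (nat \<Rightarrow> complex^'k) \<Rightarrow> complex^2 \<Rightarrow> complex^'k" where
  "binary_form d c x = (\<Sum>i\<le>d. (x $ 1 ^ i * x $ 2 ^ (d - i)) *s c i)"

definition proj_morphism :: "nat \<Rightarrow> ((complex^2) set \<Rightarrow> (complex^'k) set) \<Rightarrow> bool" where
  "proj_morphism d \<phi> \<longleftrightarrow> (\<exists>c. \<forall>x. x \<noteq> 0 \<longrightarrow>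
     binary_form d c x \<noteq> 0 \<and> \<phi> (vec.span {x}) = vec.span {binary_form d c x})"

definition flag_morphism ::
    "nat \<Rightarrow> nat \<Rightarrow> ((complex^2) set \<Rightarrow> ('m::{finite,linorder}) flag) \<Rightarrow> bool" where
  "flag_morphism d1 d2 \<phi> \<longleftrightarrow> (\<forall>l\<in>P1. \<phi> l \<in> IF12) \<and>
     proj_morphism d1 (\<lambda>l. fst (\<phi> l)) \<and> proj_morphism d2 (\<lambda>l. pluecker (snd (\<phi> l)))"

text \<open>
  A map from a two-pointed connected nodal curve of arithmetic genus \<open>0\<close>. All components of such a
  curve are copies of \<open>P1\<close>, and its dual graph is a tree, hence simple. The relation \<open>adj\<close> lists each
  node in both directions; \<open>node M v w\<close> is the point of component \<open>v\<close> that is glued to the point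
  \<open>node M w v\<close> of component \<open>w\<close>. The marked points are \<open>mark M 1\<close> and \<open>mark M 2\<close>, each consisting of a
  component and a point on it.
\<close>

record 'm pointed_map =
  comps :: "nat set"
  adj :: "(nat \<times> nat) set"
  node :: "nat \<Rightarrow> nat \<Rightarrow> (complex^2) set"
  mark :: "nat \<Rightarrow> nat \<times> (complex^2) set"
  mor :: "nat \<Rightarrow> (complex^2) set \<Rightarrow> 'm flag"

text \<open>
  For a connected graph, a tree is characterised by having one edge fewer than it has vertices;
  this is the condition that the arithmetic genus vanishes.
\<close>

definition genus0_dual_graph :: "('m::{finite,linorder}) pointed_map \<Rightarrow> bool" where
  "genus0_dual_graph M \<longleftrightarrow>
     finite (comps M) \<and> comps M \<noteq> {} \<and>
     adj M \<subseteq> comps M \<times> comps M \<and> sym (adj M) \<and> irrefl (adj M) \<and>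
     (\<forall>v\<in>comps M. \<forall>w\<in>comps M. (v, w) \<in> (adj M)\<^sup>*) \<and>
     card (adj M) = 2 * (card (comps M) - 1)"

definition nodes_on :: "('m::{finite,linorder}) pointed_map \<Rightarrow> nat \<Rightarrow> (complex^2) set set" where
  "nodes_on M v = node M v ` (adj M `` {v})"

definition marks_on :: "('m::{finite,linorder}) pointed_map \<Rightarrow> nat \<Rightarrow> (complex^2) set set" where
  "marks_on M v = {snd (mark M k) | k. k \<in> {1, 2} \<and> fst (mark M k) = v}"

definition prestable :: "('m::{finite,linorder}) pointed_map \<Rightarrow> bool" where
  "prestable M \<longleftrightarrow> genus0_dual_graph M \<and>
     (\<forall>v\<in>comps M. nodes_on M v \<subseteq> P1 \<and> inj_on (node M v) (adj M `` {v})) \<and>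
     (\<forall>k\<in>{1, 2}. fst (mark M k) \<in> comps M \<and> snd (mark M k) \<in> P1) \<and>
     (\<forall>v\<in>comps M. marks_on M v \<inter> nodes_on M v = {}) \<and>
     mark M 1 \<noteq> mark M 2 \<and>
     (\<forall>(v, w)\<in>adj M. mor M v (node M v w) = mor M w (node M w v))"

definition has_degree :: "('m::{finite,linorder}) pointed_map \<Rightarrow> nat \<times> nat \<Rightarrow> bool" where
  "has_degree M d \<longleftrightarrow> (\<exists>d1 d2.
     (\<forall>v\<in>comps M. flag_morphism (d1 v) (d2 v) (mor M v)) \<and>
     d = (\<Sum>v\<in>comps M. d1 v, \<Sum>v\<in>comps M. d2 v))"

definition contracted :: "('m::{finite,linorder}) pointed_map \<Rightarrow> nat \<Rightarrow> bool" where
  "contracted M v \<longleftrightarrow> (\<exists>F. \<forall>l\<in>P1. mor M v l = F)"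

definition stable :: "('m::{finite,linorder}) pointed_map \<Rightarrow> bool" where
  "stable M \<longleftrightarrow> (\<forall>v\<in>comps M. contracted M v \<longrightarrow> card (nodes_on M v \<union> marks_on M v) \<ge> 3)"

text \<open>
  The points of the moduli space are the stable maps up to isomorphism. The set below consists of
  the stable maps themselves; since the evaluation maps take the same value on isomorphic stable maps, this
  does not affect images and preimages under them.
\<close>

definition Mbar :: "nat \<times> nat \<Rightarrow> ('m::{finite,linorder}) pointed_map set" where
  "Mbar d = {M. prestable M \<and> has_degree M d \<and> stable M}"

definition ev :: "nat \<Rightarrow> ('m::{finite,linorder}) pointed_map \<Rightarrow> 'm flag" where
  "ev k M = mor M (fst (mark M k)) (snd (mark M k))"

definition curve_nbhd :: "nat \<times> nat \<Rightarrow> ('m::{finite,linorder}) flag set \<Rightarrow> 'm flag set" where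
  "curve_nbhd d \<Omega> = (if d = (0, 0) then \<Omega> else ev 2 ` {M \<in> Mbar d. ev 1 M \<in> \<Omega>})"

definition inclusion_order :: "'a set set \<Rightarrow> 'a set gorder" where
  "inclusion_order L = \<lparr>carrier = L, eq = (=), le = (\<subseteq>)\<rparr>"

definition distributive_lattice :: "('a, 'b) gorder_scheme \<Rightarrow> bool" where
  "distributive_lattice L \<longleftrightarrow> Lattice.lattice L \<and>
     (\<forall>x\<in>carrier L. \<forall>y\<in>carrier L. \<forall>z\<in>carrier L.
        x \<squnion>\<^bsub>L\<^esub> (y \<sqinter>\<^bsub>L\<^esub> z) = (x \<squnion>\<^bsub>L\<^esub> y) \<sqinter>\<^bsub>L\<^esub> (x \<squnion>\<^bsub>L\<^esub> z))"

end

theory Submission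
  imports Defs
begin

text \<open>
  Let \<open>F = (V1, V2)\<close> be a point of \<open>IF12\<close>. A curve of degree \<open>(d, 0)\<close> keeps \<open>V2\<close> fixed and one of degree
  \<open>(0, d)\<close> keeps \<open>V1\<close> fixed. In degree \<open>(d, 1)\<close> the planes form a pencil, hence any two of them meet in
  a nonzero vector. Conversely, if \<open>d > 0\<close> then all flags subject to these constraints are reached:
  for \<open>V2 = span {w, u}\<close> and \<open>V2' = span {w, v}\<close> one uses the curve
  \<open>span {s u + t v} \<subseteq> span {w, s u + t v}\<close> of degree \<open>(1, 1)\<close>. Finally, any two flags
  \<open>span {x} \<subseteq> span {x, u}\<close> and \<open>span {y} \<subseteq> span {y, v}\<close> lie on a curve of degree \<open>(1, 2)\<close>: if
  \<open>omega x y = 0\<close>, go through \<open>span {x, y}\<close>; otherwise change \<open>v\<close> by a multiple of \<open>y\<close> so that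
  \<open>span {s x + t y, s u + t v}\<close> is isotropic for all \<open>(s, t)\<close>.

  So every \<open>\<Omega> \<subseteq> IF12\<close> has at most five curve neighborhoods, those of degree \<open>(0, 0)\<close>, \<open>(1, 0)\<close>,
  \<open>(0, 1)\<close>, \<open>(1, 1)\<close> and \<open>(1, 2)\<close>. They form a square with a top element, or a quotient of it.
\<close>


section \<open>Exterior square\<close>

text \<open>The bilinear pairing, with no complex conjugation; vectors \<open>f\<close> thus stand
  for linear functionals on \<open>E\<close>.\<close>

definition pairing :: "'m::finite evec \<Rightarrow> 'm evec \<Rightarrow> complex" where
  "pairing u f = (\<Sum>j\<in>UNIV. u $ j * f $ j)"

text \<open>Interior product of a 2-tensor with the functional \<open>f\<close>. It serves to
  recover the vectors of a plane from its Pluecker vector.\<close>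

definition contraction :: "('m::finite \<times> 'm) evec \<Rightarrow> 'm evec \<Rightarrow> 'm evec" where
  "contraction p f = (\<chi> i. \<Sum>j\<in>UNIV. p $ (i, j) * f $ j)"

lemma wedge_self [simp]: "wedge u u = 0"
  by (vector wedge_def)

lemma wedge_zero [simp]: "wedge 0 u = 0" "wedge u 0 = 0"
  by (vector wedge_def)+

lemma wedge_commute: "wedge u v = - wedge v u"
  by (vector wedge_def algebra_simps)

lemma wedge_add_left: "wedge (u + u') v = wedge u v + wedge u' v"
  by (vector wedge_def algebra_simps)

lemma wedge_add_right: "wedge u (v + v') = wedge u v + wedge u v'"
  by (vector wedge_def algebra_simps)

lemma wedge_scale_left: "wedge (k *s u) v = k *s wedge u v"
  by (vector wedge_def algebra_simps)

lemma wedge_scale_right: "wedge u (k *s v) = k *s wedge u v"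
  by (vector wedge_def algebra_simps)

lemmas wedge_simps = wedge_add_left wedge_add_right wedge_scale_left wedge_scale_right

lemma contraction_wedge: "contraction (wedge u v) f = pairing v f *s u - pairing u f *s v"
  by (vector wedge_def contraction_def pairing_def sum_distrib_left sum_subtractf algebra_simps)

lemma contraction_zero [simp]: "contraction 0 f = 0"
  by (vector contraction_def)

lemma contraction_add: "contraction (p + q) f = contraction p f + contraction q f"
  by (vector contraction_def sum.distrib algebra_simps)

lemma contraction_scale: "contraction (k *s p) f = k *s contraction p f"
  by (vector contraction_def sum_distrib_left algebra_simps)

lemma separating_functional:
  fixes v :: "'m::finite evec"
  assumes "vec.subspace S" "v \<notin> S"
  obtains f where "\<And>u. u \<in> S \<Longrightarrow> pairing u f = 0" "pairing v f = 1"
proof -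
  obtain B where B: "B \<subseteq> S" "vec.independent B" "S \<subseteq> vec.span B"
    using vec.maximal_independent_subset by blast
  have span_B: "vec.span B = S"
    using B assms(1) by (metis subset_antisym vec.span_minimal)
  have "vec.independent (insert v B)"
    using B assms(2) span_B by (intro vec.independent_insertI) auto
  then obtain g :: "'m evec \<Rightarrow> 'm evec" where g: "Vector_Spaces.linear (*s) (*s) g"
    "\<And>x. x \<in> insert v B \<Longrightarrow> g x = (if x = v then 1 else 0)"
    using vec.linear_independent_extend[of "insert v B" "\<lambda>x. if x = v then 1 else 0"] by blast
  \<comment> \<open>The extension \<open>g\<close> is vector-valued and sends \<open>v\<close> to
    the all-ones vector, so every coordinate of \<open>g\<close> is a functional with value 1 at
    \<open>v\<close>; \<open>i\<close> is an arbitrary choice.\<close>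
  define i :: 'm where "i = undefined"
  define f :: "'m evec" where "f = (\<chi> j. g (axis j 1) $ i)"
  have pairing_f: "pairing x f = g x $ i" for x
    by (simp add: pairing_def f_def linear_componentwise[OF g(1), of x i])
  have "g u = 0" if "u \<in> S" for u
  proof -
    interpret g: Vector_Spaces.linear "(*s)" "(*s)" g by (rule g(1))
    have "u \<in> vec.span B" using that span_B by simp
    moreover have "g x = 0" if "x \<in> B" for x
      using g(2)[of x] that B(1) assms(2) by auto
    ultimately show ?thesis by (rule g.eq_0_on_span[rotated])
  qed
  with g(2)[of v] show thesis
    by (intro that[of f]) (auto simp: pairing_f)
qed

text \<open>Contracting \<open>wedge u v = 0\<close> with a functional that is 1 at \<open>u\<close>
  solves for \<open>v\<close> as a multiple of \<open>u\<close>.\<close>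

lemma wedge_eq_0_iff: "wedge u v = 0 \<longleftrightarrow> u = 0 \<or> v \<in> vec.span {u}"
proof
  assume *: "wedge u v = 0"
  show "u = 0 \<or> v \<in> vec.span {u}"
  proof (cases "u = 0")
    case False
    then obtain f where f: "pairing u f = 1"
      using separating_functional[of "{0}" u] vec.subspace_single_0 by auto
    have "contraction (wedge u v) f = 0" using * by simp
    then have "v = pairing v f *s u" by (simp add: contraction_wedge f)
    moreover have "pairing v f *s u \<in> vec.span {u}"
      by (intro vec.span_scale vec.span_base) simp
    ultimately show ?thesis by simp
  qed auto
next
  assume "u = 0 \<or> v \<in> vec.span {u}"
  then show "wedge u v = 0"
    by (auto simp: vec.span_singleton wedge_scale_right)
qed

section \<open>Lines and planes as spans\<close>

lemma span_pair: "vec.span {u, v} = {a *s u + b *s v | a b. True}"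
  by (auto simp: vec.span_insert vec.span_singleton algebra_simps)

lemma dim_span_pair:
  assumes "wedge u v \<noteq> 0"
  shows "vec.dim (vec.span {u, v}) = 2"
proof -
  have uv: "u \<noteq> 0" "v \<notin> vec.span {u}" using assms by (auto simp: wedge_eq_0_iff)
  then have "vec.independent {v, u}"
    by (intro vec.independent_insertI) (auto simp: vec.independent_empty)
  moreover have "v \<noteq> u" using uv by (auto intro: vec.span_base)
  ultimately have "vec.independent {v, u}" "v \<noteq> u" .
  then show ?thesis
    by (metis card_2_iff insert_commute vec.dim_span_eq_card_independent)
qed

lemma dim_span_singleton: "u \<noteq> 0 \<Longrightarrow> vec.dim (vec.span {u}) = 1"
  by (simp add: vec.dim_span_eq_card_independent)

lemma subspace_eq_of_dim:
  "vec.subspace S \<Longrightarrow> vec.subspace T \<Longrightarrow> S \<subseteq> T \<Longrightarrow> vec.dim S = vec.dim T \<Longrightarrow> S = T"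
  by (intro vec.subspace_dim_equal) auto

lemma line_eq_span:
  assumes "vec.subspace V" "vec.dim V = 1" "x \<in> V" "x \<noteq> 0"
  shows "V = vec.span {x}"
  using assms by (intro subspace_eq_of_dim[symmetric])
    (auto simp: vec.span_minimal dim_span_singleton)

lemma plane_eq_span:
  assumes "vec.subspace V" "vec.dim V = 2" "u \<in> V" "v \<in> V" "wedge u v \<noteq> 0"
  shows "V = vec.span {u, v}"
  using assms by (intro subspace_eq_of_dim[symmetric])
    (auto simp: vec.span_minimal dim_span_pair simp del: vec.dim_span)

lemma line_nonzero:
  assumes "vec.subspace V" "vec.dim V = 1"
  obtains x where "x \<in> V" "x \<noteq> 0" "V = vec.span {x}"
proof -
  have "\<not> V \<subseteq> {0}"
  proof
    assume "V \<subseteq> {0}"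
    then have "V \<subseteq> vec.span {}" by simp
    from vec.dim_subset[OF this] assms(2) show False by (simp add: vec.dim_span)
  qed
  then obtain x where "x \<in> V" "x \<noteq> 0" by blast
  with line_eq_span[OF assms] that show thesis by blast
qed

lemma plane_extend:
  assumes "vec.subspace V" "vec.dim V = 2" "u \<in> V" "u \<noteq> 0"
  obtains v where "v \<in> V" "wedge u v \<noteq> 0" "V = vec.span {u, v}"
proof -
  have "\<not> V \<subseteq> vec.span {u}"
    using vec.dim_subset[of V "vec.span {u}"] assms(2,4) by (auto simp: dim_span_singleton simp del: vec.dim_span)
  then obtain v where "v \<in> V" "v \<notin> vec.span {u}" by blast
  with assms have "wedge u v \<noteq> 0" by (simp add: wedge_eq_0_iff)
  with \<open>v \<in> V\<close> plane_eq_span[OF assms(1-3)] that show thesis by blast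
qed

lemma plane_basis:
  assumes "vec.subspace V" "vec.dim V = 2"
  obtains u v where "wedge u v \<noteq> 0" "V = vec.span {u, v}"
proof -
  have "\<not> V \<subseteq> {0}"
  proof
    assume "V \<subseteq> {0}"
    then have "V \<subseteq> vec.span {}" by simp
    from vec.dim_subset[OF this] assms(2) show False by (simp add: vec.dim_span)
  qed
  then obtain u where "u \<in> V" "u \<noteq> 0" by blast
  with plane_extend[OF assms] that show thesis by blast
qed

lemma span_scale_generator:
  assumes "k \<noteq> 0"
  shows "vec.span {k *s u} = vec.span {u}"
  using vec.span_image_scale[of "{u}" "\<lambda>_. k"] assms by simp

lemma span_scale_generators:
  assumes "k \<noteq> 0" "l \<noteq> 0"
  shows "vec.span {k *s u, l *s v} = vec.span {u, v}"
proof (intro subset_antisym vec.span_minimal vec.subspace_span subsetI)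
  fix w assume "w \<in> {k *s u, l *s v}"
  then show "w \<in> vec.span {u, v}" by (auto intro: vec.span_scale vec.span_base)
next
  fix w assume "w \<in> {u, v}"
  moreover have "inverse k *s (k *s u) \<in> vec.span {k *s u, l *s v}"
    "inverse l *s (l *s v) \<in> vec.span {k *s u, l *s v}"
    by (intro vec.span_scale vec.span_base; simp)+
  ultimately show "w \<in> vec.span {k *s u, l *s v}"
    using assms by (auto simp: vec.scale_scale)
qed

section \<open>Pluecker coordinates\<close>

text \<open>The wedge of two vectors of the plane is the determinant of their coefficients times
  \<open>wedge u v\<close>, so \<open>pluecker\<close> depends only on the plane.\<close>

lemma pluecker_span: "pluecker (vec.span {u, v}) = vec.span {wedge u v}"
proof -
  have "wedge x y \<in> vec.span {wedge u v}" if "x \<in> vec.span {u, v}" "y \<in> vec.span {u, v}" for x y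
  proof -
    from that obtain a b c d where "x = a *s u + b *s v" "y = c *s u + d *s v"
      by (auto simp: span_pair)
    then have "wedge x y = (a * d - b * c) *s wedge u v"
      by (vector wedge_def algebra_simps)
    then show ?thesis by (metis singletonI vec.span_base vec.span_scale)
  qed
  then show ?thesis
    unfolding pluecker_def
    by (intro subset_antisym vec.span_minimal vec.span_mono) (auto intro: vec.span_base)
qed

lemma contraction_pluecker_mem:
  assumes "vec.subspace V" "vec.dim V = 2" "p \<in> pluecker V"
  shows "contraction p f \<in> V"
proof -
  obtain u v where V: "V = vec.span {u, v}" using plane_basis[OF assms(1,2)] .
  then obtain k where "p = k *s wedge u v"
    using assms(3) by (auto simp: pluecker_span vec.span_singleton)
  then have "contraction p f = (k * pairing v f) *s u + (- k * pairing u f) *s v"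
    by (simp add: contraction_scale contraction_wedge vec.scale_right_diff_distrib)
  then show ?thesis unfolding V span_pair by blast
qed

text \<open>A functional that vanishes at \<open>u\<close> and is 1 at \<open>v\<close> contracts
  \<open>wedge u v\<close> to \<open>u\<close>. Since \<open>W\<close> meets \<open>V\<close>
  trivially, it can also be made to vanish on \<open>W\<close>, so functionals killing
  \<open>W\<close> already recover all of \<open>V\<close>.\<close>

lemma plane_subset_of_contraction:
  assumes V: "vec.subspace V" "vec.dim V = 2" and W: "vec.subspace W" "W \<inter> V = {0}"
    and T: "vec.subspace T" and p: "pluecker V = vec.span {p}"
    and *: "\<And>f. (\<And>w. w \<in> W \<Longrightarrow> pairing w f = 0) \<Longrightarrow> contraction p f \<in> T"
  shows "V \<subseteq> T"
proof
  fix u assume "u \<in> V"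
  show "u \<in> T"
  proof (cases "u = 0")
    case True
    then show ?thesis using T by (simp add: vec.subspace_0)
  next
    case False
    obtain v where v: "v \<in> V" "wedge u v \<noteq> 0" "V = vec.span {u, v}"
      using plane_extend[OF V \<open>u \<in> V\<close> False] .
    let ?S = "vec.span (insert u W)"
    \<comment> \<open>Otherwise some \<open>v - k *s u\<close> would lie in both \<open>W\<close>
      and \<open>V\<close>, hence be 0.\<close>
    have "v \<notin> ?S"
    proof
      assume "v \<in> ?S"
      then obtain k where k: "v - k *s u \<in> vec.span W" by (auto simp: vec.span_insert)
      have "v - k *s u \<in> V" using V(1) v(1) \<open>u \<in> V\<close>
        by (simp add: vec.subspace_diff vec.subspace_scale)
      with k W have "v = k *s u"
        by (metis IntI eq_iff_diff_eq_0 singletonD vec.span_eq_iff)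
      with v(2) show False by (simp add: wedge_scale_right)
    qed
    then obtain f where f: "\<And>w. w \<in> ?S \<Longrightarrow> pairing w f = 0" "pairing v f = 1"
      using separating_functional[OF vec.subspace_span] by metis
    have "contraction (wedge u v) f = u"
      using f by (simp add: contraction_wedge vec.span_base)
    moreover have "contraction p f \<in> T" using f by (intro *) (auto intro: vec.span_base)
    moreover have "wedge u v \<in> vec.span {p}"
      using p v(3) pluecker_span[of u v] by (metis singletonI vec.span_base)
    ultimately show "u \<in> T"
      using T by (auto simp: vec.span_singleton contraction_scale dest: vec.subspace_scale)
  qed
qed

text \<open>The plane is the set of contractions of its Pluecker vector; this is the previous
  containment with zero auxiliary subspace.\<close>

lemma pluecker_inj:
  assumes "vec.subspace V" "vec.dim V = 2" "vec.subspace W" "vec.dim W = 2"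
    and "pluecker V = pluecker W"
  shows "V = W"
proof -
  obtain u v where V: "V = vec.span {u, v}" using plane_basis[OF assms(1,2)] .
  have "V \<subseteq> W"
  proof (rule plane_subset_of_contraction[OF assms(1,2), of "{0}"])
    show "pluecker V = vec.span {wedge u v}" by (simp add: V pluecker_span)
    then show "contraction (wedge u v) f \<in> W" for f
      using assms by (intro contraction_pluecker_mem) (auto intro: vec.span_base)
  qed (use assms in \<open>auto simp: vec.subspace_0 intro: vec.subspace_single_0\<close>)
  with assms show ?thesis by (intro subspace_eq_of_dim) auto
qed

text \<open>A sum of two decomposable bivectors is decomposable only if their planes meet. If they
  did not, functionals killing \<open>W\<close> would annihilate \<open>q\<close>, so contractions
  of \<open>p + q\<close> would fill out \<open>V\<close>, and symmetrically \<open>W\<close>; then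
  \<open>V = T = W\<close>.\<close>

lemma pencil_planes_meet:
  fixes V :: "'a::finite evec set"
  assumes V: "vec.subspace V" "vec.dim V = 2" "pluecker V = vec.span {p}"
    and W: "vec.subspace W" "vec.dim W = 2" "pluecker W = vec.span {q}"
    and T: "vec.subspace T" "vec.dim T = 2" "pluecker T = vec.span {p + q}"
  shows "V \<inter> W \<noteq> {0}"
proof
  assume meet: "V \<inter> W = {0}"
  have zero: "contraction r f = 0"
    if S: "vec.subspace S" "vec.dim S = 2" "pluecker S = vec.span {r}" "\<And>w. w \<in> S \<Longrightarrow> pairing w f = 0"
    for S :: "'a evec set" and f r
  proof -
    obtain u v where uv: "S = vec.span {u, v}" using plane_basis[OF S(1,2)] .
    then have "r \<in> vec.span {wedge u v}" using S(3) by (simp add: pluecker_span vec.span_base)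
    moreover have "contraction (wedge u v) f = 0"
      using S(4) by (simp add: contraction_wedge uv vec.span_base)
    ultimately show ?thesis by (auto simp: vec.span_singleton contraction_scale)
  qed
  have mem: "contraction p f + contraction q f \<in> T" for f
    using contraction_pluecker_mem[OF T(1,2), of "p + q"] T(3)
    by (simp add: contraction_add vec.span_base)
  have "V \<subseteq> T"
    using plane_subset_of_contraction[OF V(1,2) W(1) _ T(1) V(3)] mem zero[OF W] meet
    by (metis Int_commute add.right_neutral)
  moreover have "W \<subseteq> T"
    using plane_subset_of_contraction[OF W(1,2) V(1) _ T(1) W(3)] mem zero[OF V] meet
    by (metis add.left_neutral)
  ultimately have "V = W" using V W T by (metis subspace_eq_of_dim)
  with meet V(2) show False by simp
qed


section \<open>Isotropic flags\<close>

lemma omega_add_left: "omega (x + x') y = omega x y + omega x' y"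
  by (simp add: omega_def case_prod_unfold sum.distrib[symmetric] algebra_simps)

lemma omega_scale_left: "omega (k *s x) y = k * omega x y"
  by (simp add: omega_def case_prod_unfold sum_distrib_left algebra_simps)

lemma omega_skew: "omega y x = - omega x y"
  by (simp add: omega_def case_prod_unfold sum_negf[symmetric] algebra_simps)

lemma omega_self [simp]: "omega x x = 0"
  by (simp add: omega_def)

lemma omega_add_right: "omega x (y + y') = omega x y + omega x y'"
  using omega_add_left[of y y' x] omega_skew[of x "y + y'"] omega_skew[of x y] omega_skew[of x y']
  by simp

lemma omega_scale_right: "omega x (k *s y) = k * omega x y"
  using omega_scale_left[of k y x] omega_skew[of x "k *s y"] omega_skew[of x y] by simp

lemmas omega_simps = omega_add_left omega_add_right omega_scale_left omega_scale_right

lemma isotropic_span_pair: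
  assumes "omega x y = 0"
  shows "isotropic (vec.span {x, y})"
  unfolding isotropic_def span_pair using assms
  by (auto simp: omega_simps omega_skew[of y x])

lemma isotropic_subset: "isotropic V \<Longrightarrow> U \<subseteq> V \<Longrightarrow> isotropic U"
  by (auto simp: isotropic_def)

lemma IF12_D:
  assumes "F \<in> IF12"
  shows "vec.subspace (fst F)" "vec.dim (fst F) = 1" "vec.subspace (snd F)" "vec.dim (snd F) = 2"
    "isotropic (snd F)" "fst F \<subseteq> snd F"
  using assms by (auto simp: IF12_def)

lemma span_flag_in_IF12:
  assumes "wedge x u \<noteq> 0" "omega x u = 0"
  shows "(vec.span {x}, vec.span {x, u}) \<in> IF12"
proof -
  have "x \<noteq> 0" using assms(1) by auto
  moreover have "vec.span {x} \<subseteq> vec.span {x, u}" by (intro vec.span_mono) auto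
  ultimately show ?thesis
    using dim_span_pair[OF assms(1)] isotropic_span_pair[OF assms(2)]
    by (auto simp: IF12_def dim_span_singleton isotropic_subset simp del: vec.dim_span)
qed

lemma line_in_flag_in_IF12:
  assumes "F \<in> IF12" "x \<in> snd F" "x \<noteq> 0"
  shows "(vec.span {x}, snd F) \<in> IF12"
proof -
  have "vec.span {x} \<subseteq> snd F" using IF12_D[OF assms(1)] assms(2) by (intro vec.span_minimal) auto
  then show ?thesis
    using IF12_D[OF assms(1)] assms(3)
    by (auto simp: IF12_def dim_span_singleton isotropic_subset simp del: vec.dim_span)
qed

lemma IF12_adapted_basis:
  assumes "F \<in> IF12" "x \<in> snd F" "x \<noteq> 0"
  obtains u where "wedge x u \<noteq> 0" "omega x u = 0" "snd F = vec.span {x, u}" "u \<in> snd F"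
proof -
  note F = IF12_D[OF assms(1)]
  obtain u where u: "u \<in> snd F" "wedge x u \<noteq> 0" "snd F = vec.span {x, u}"
    using plane_extend[OF F(3,4) assms(2,3)] .
  moreover have "omega x u = 0" using F(5) assms(2) u(1) by (auto simp: isotropic_def)
  ultimately show thesis using that by blast
qed

lemma IF12_line:
  assumes "F \<in> IF12"
  obtains x where "x \<noteq> 0" "fst F = vec.span {x}" "x \<in> snd F"
proof -
  obtain x where "x \<in> fst F" "x \<noteq> 0" "fst F = vec.span {x}"
    using line_nonzero[OF IF12_D(1,2)[OF assms]] .
  then show thesis using IF12_D(6)[OF assms] that by auto
qed

section \<open>Morphisms of low degree\<close>

lemma P1_iff: "l \<in> P1 \<longleftrightarrow> (\<exists>z. z \<noteq> 0 \<and> l = vec.span {z})"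
proof
  assume "l \<in> P1"
  then have "vec.subspace l" "vec.dim l = 1" by (auto simp: P1_def)
  then show "\<exists>z. z \<noteq> 0 \<and> l = vec.span {z}" by (metis line_nonzero)
qed (auto simp: P1_def dim_span_singleton simp del: vec.dim_span)

lemma proj_morphism_0_const:
  assumes "proj_morphism 0 \<phi>" "l \<in> P1" "l' \<in> P1"
  shows "\<phi> l = \<phi> l'"
proof -
  obtain c where "\<And>z. z \<noteq> 0 \<Longrightarrow> \<phi> (vec.span {z}) = vec.span {binary_form 0 c z}"
    using assms(1) unfolding proj_morphism_def by blast
  then have "\<And>z. z \<noteq> 0 \<Longrightarrow> \<phi> (vec.span {z}) = vec.span {c 0}"
    by (simp add: binary_form_def)
  with assms(2,3) show ?thesis unfolding P1_iff by metis
qed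

lemma flag_morphism_fst_const:
  "flag_morphism 0 d2 \<phi> \<Longrightarrow> l \<in> P1 \<Longrightarrow> l' \<in> P1 \<Longrightarrow> fst (\<phi> l) = fst (\<phi> l')"
  unfolding flag_morphism_def using proj_morphism_0_const by blast

lemma flag_morphism_snd_const:
  assumes "flag_morphism d1 0 \<phi>" "l \<in> P1" "l' \<in> P1"
  shows "snd (\<phi> l) = snd (\<phi> l')"
proof -
  have IF: "\<phi> l \<in> IF12" "\<phi> l' \<in> IF12" using assms unfolding flag_morphism_def by blast+
  have "pluecker (snd (\<phi> l)) = pluecker (snd (\<phi> l'))"
    using assms proj_morphism_0_const[of "\<lambda>l. pluecker (snd (\<phi> l))"]
    unfolding flag_morphism_def by blast
  then show ?thesis by (rule pluecker_inj[OF IF12_D(3,4)[OF IF(1)] IF12_D(3,4)[OF IF(2)]])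
qed

lemma IF12_snd_nonzero:
  assumes "F \<in> IF12"
  shows "snd F \<noteq> {0}"
proof
  assume "snd F = {0}"
  with IF12_D(4)[OF assms] show False by simp
qed

text \<open>A form of degree 1 is additive, so the Pluecker vectors at \<open>z\<close>,
  \<open>w\<close> and \<open>z + w\<close> are of the shape \<open>p\<close>, \<open>q\<close> and
  \<open>p + q\<close>.\<close>

lemma flag_morphism_snd_meet:
  assumes \<phi>: "flag_morphism d1 1 \<phi>" and l: "l \<in> P1" "l' \<in> P1"
  shows "snd (\<phi> l) \<inter> snd (\<phi> l') \<noteq> {0}"
proof (cases "l = l'")
  case True
  moreover have "\<phi> l \<in> IF12" using \<phi> l unfolding flag_morphism_def by blast
  ultimately show ?thesis using IF12_snd_nonzero by simp
next
  case False
  obtain z w where zw: "z \<noteq> 0" "w \<noteq> 0" "l = vec.span {z}" "l' = vec.span {w}"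
    using l unfolding P1_iff by auto
  \<comment> \<open>The third point of the pencil must be a genuine point of \<open>P1\<close>; this
    is where \<open>l \<noteq> l'\<close> enters.\<close>
  have "z + w \<noteq> 0"
  proof
    assume "z + w = 0"
    then have "z = (- 1) *s w" by (simp add: add_eq_0_iff2)
    with False zw show False by (metis span_scale_generator neg_equal_0_iff_equal one_neq_zero)
  qed
  obtain c where c: "\<And>z. z \<noteq> 0 \<Longrightarrow>
      pluecker (snd (\<phi> (vec.span {z}))) = vec.span {binary_form 1 c z}"
    using \<phi> unfolding flag_morphism_def proj_morphism_def by blast
  have IF: "\<phi> (vec.span {z}) \<in> IF12" if "z \<noteq> 0" for z
  proof -
    have "vec.span {z} \<in> P1" using that P1_iff by blast
    with \<phi> show ?thesis unfolding flag_morphism_def by blast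
  qed
  have "binary_form 1 c (z + w) = binary_form 1 c z + binary_form 1 c w"
    by (simp add: binary_form_def vec.scale_left_distrib)
  with c[OF \<open>z + w \<noteq> 0\<close>]
  have "pluecker (snd (\<phi> (vec.span {z + w}))) = vec.span {binary_form 1 c z + binary_form 1 c w}"
    by simp
  then show ?thesis unfolding zw(3,4)
    by (rule pencil_planes_meet[OF IF12_D(3,4)[OF IF[OF zw(1)]] c[OF zw(1)]
        IF12_D(3,4)[OF IF[OF zw(2)]] c[OF zw(2)] IF12_D(3,4)[OF IF[OF \<open>z + w \<noteq> 0\<close>]]])
qed

section \<open>Constraints along stable maps\<close>

lemma prestable_node_P1:
  assumes "prestable M" "(v, w) \<in> adj M"
  shows "node M v w \<in> P1" "node M w v \<in> P1"
proof -
  have "sym (adj M)" "adj M \<subseteq> comps M \<times> comps M"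
    and nodes: "\<forall>v\<in>comps M. nodes_on M v \<subseteq> P1"
    using assms(1) by (auto simp: prestable_def genus0_dual_graph_def)
  then have "(w, v) \<in> adj M" "v \<in> comps M" "w \<in> comps M" using assms(2) by (auto dest: symD)
  with nodes assms(2) show "node M v w \<in> P1" "node M w v \<in> P1"
    by (auto simp: nodes_on_def)
qed

text \<open>Walk through the dual graph starting from \<open>v0\<close>: on any other component
  \<open>h\<close> is constant, hence equal to its value at the node through which the walk enters.
  So \<open>h\<close> takes no values beyond those on \<open>v0\<close>. It is used with
  \<open>h\<close> one of the two projections of a flag.\<close>

lemma prestable_image_on_component:
  assumes M: "prestable M" and v0: "v0 \<in> comps M"
    and const: "\<And>v l l'. v \<in> comps M \<Longrightarrow> v \<noteq> v0 \<Longrightarrow> l \<in> P1 \<Longrightarrow> l' \<in> P1 \<Longrightarrow>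
      h (mor M v l) = h (mor M v l')"
    and v: "v \<in> comps M" "l \<in> P1"
  shows "\<exists>l0\<in>P1. h (mor M v l) = h (mor M v0 l0)"
proof -
  have conn: "(v0, v) \<in> (adj M)\<^sup>*" and sub: "adj M \<subseteq> comps M \<times> comps M"
    and glue: "\<And>v w. (v, w) \<in> adj M \<Longrightarrow> mor M v (node M v w) = mor M w (node M w v)"
    using M v0 v(1) by (auto simp: prestable_def genus0_dual_graph_def)
  from conn have "\<forall>l\<in>P1. \<exists>l0\<in>P1. h (mor M v l) = h (mor M v0 l0)"
  proof (induction rule: rtrancl_induct)
    case base
    then show ?case by blast
  next
    case (step v w)
    show ?case
    proof (cases "w = v0")
      case False
      have "h (mor M w l) = h (mor M v (node M v w))" if "l \<in> P1" for l
        using const[of w l "node M w v"] False sub step.hyps(2) that glue[OF step.hyps(2)]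
          prestable_node_P1[OF M step.hyps(2)] by auto
      then show ?thesis using step.IH prestable_node_P1[OF M step.hyps(2)] by metis
    qed blast
  qed
  then show ?thesis using v(2) by blast
qed

lemma Mbar_mark:
  assumes "M \<in> Mbar d" "k \<in> {1, 2}"
  shows "fst (mark M k) \<in> comps M" "snd (mark M k) \<in> P1"
  using assms by (auto simp: Mbar_def prestable_def)

lemma Mbar_degree:
  assumes "M \<in> Mbar (d1, d2)"
  obtains e1 e2 where "\<forall>v\<in>comps M. flag_morphism (e1 v) (e2 v) (mor M v)"
    "(\<Sum>v\<in>comps M. e1 v) = d1" "(\<Sum>v\<in>comps M. e2 v) = d2"
  using assms by (auto simp: Mbar_def has_degree_def)

lemma Mbar_finite_comps: "M \<in> Mbar d \<Longrightarrow> finite (comps M)"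
  by (auto simp: Mbar_def prestable_def genus0_dual_graph_def)

lemma Mbar_prestable: "M \<in> Mbar d \<Longrightarrow> prestable M"
  by (auto simp: Mbar_def)

lemma ev_in_IF12:
  assumes "M \<in> Mbar d" "k \<in> {1, 2}"
  shows "ev k M \<in> IF12"
proof -
  obtain d1 d2 where "d = (d1, d2)" by force
  then obtain e1 e2 where "\<forall>v\<in>comps M. flag_morphism (e1 v) (e2 v) (mor M v)"
    using Mbar_degree[of M d1 d2] assms(1) by blast
  with Mbar_mark[OF assms] show ?thesis by (auto simp: ev_def flag_morphism_def)
qed

lemma prestable_const:
  assumes "M \<in> Mbar d"
    and const: "\<And>v l l'. v \<in> comps M \<Longrightarrow> l \<in> P1 \<Longrightarrow> l' \<in> P1 \<Longrightarrow> h (mor M v l) = h (mor M v l')"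
  shows "h (ev 1 M) = h (ev 2 M)"
proof -
  have mark1: "fst (mark M 1) \<in> comps M" "snd (mark M 1) \<in> P1"
    and mark2: "fst (mark M 2) \<in> comps M" "snd (mark M 2) \<in> P1"
    using Mbar_mark[OF assms(1)] by auto
  have "\<exists>l0\<in>P1. h (mor M (fst (mark M 2)) (snd (mark M 2))) = h (mor M (fst (mark M 1)) l0)"
    by (rule prestable_image_on_component[where h = h,
          OF Mbar_prestable[OF assms(1)] mark1(1) _ mark2]) (rule const)
  then obtain l0 where l0: "l0 \<in> P1" "h (ev 2 M) = h (mor M (fst (mark M 1)) l0)"
    unfolding ev_def by blast
  then show ?thesis
    using const[OF mark1(1) mark1(2) l0(1)] unfolding ev_def by simp
qed

text \<open>Degrees are natural numbers, so a total of 0 forces degree 0 on every component.\<close>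

lemma Mbar_fst_const:
  assumes "M \<in> Mbar (0, d2)"
  shows "fst (ev 1 M) = fst (ev 2 M)"
proof -
  obtain e1 e2 where e: "\<forall>v\<in>comps M. flag_morphism (e1 v) (e2 v) (mor M v)"
    "(\<Sum>v\<in>comps M. e1 v) = 0" "(\<Sum>v\<in>comps M. e2 v) = d2"
    by (rule Mbar_degree[OF assms])
  then have "flag_morphism 0 (e2 v) (mor M v)" if "v \<in> comps M" for v
    using e that Mbar_finite_comps[OF assms] by (metis sum_eq_0_iff)
  then show ?thesis
    by (intro prestable_const[OF assms]) (rule flag_morphism_fst_const)
qed

lemma Mbar_snd_const:
  assumes "M \<in> Mbar (d1, 0)"
  shows "snd (ev 1 M) = snd (ev 2 M)"
proof -
  obtain e1 e2 where e: "\<forall>v\<in>comps M. flag_morphism (e1 v) (e2 v) (mor M v)"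
    "(\<Sum>v\<in>comps M. e1 v) = d1" "(\<Sum>v\<in>comps M. e2 v) = 0"
    by (rule Mbar_degree[OF assms])
  then have "flag_morphism (e1 v) 0 (mor M v)" if "v \<in> comps M" for v
    using e that Mbar_finite_comps[OF assms] by (metis sum_eq_0_iff)
  then show ?thesis
    by (intro prestable_const[OF assms]) (rule flag_morphism_snd_const)
qed

text \<open>A total of 1 is carried by a single component \<open>v0\<close>. All others have a
  constant plane, so the planes at both marked points already occur on \<open>v0\<close>, where the
  statement for one morphism applies.\<close>

lemma Mbar_snd_meet:
  assumes "M \<in> Mbar (d1, 1)"
  shows "snd (ev 1 M) \<inter> snd (ev 2 M) \<noteq> {0}"
proof -
  obtain e1 e2 where e: "\<forall>v\<in>comps M. flag_morphism (e1 v) (e2 v) (mor M v)"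
    "(\<Sum>v\<in>comps M. e1 v) = d1" "(\<Sum>v\<in>comps M. e2 v) = 1"
    by (rule Mbar_degree[OF assms])
  obtain v0 where v0: "v0 \<in> comps M" "e2 v0 = 1" "\<And>v. v \<in> comps M \<Longrightarrow> v \<noteq> v0 \<Longrightarrow> e2 v = 0"
    using e(3) sum_eq_1_iff[OF Mbar_finite_comps[OF assms], of e2] by auto
  have const: "snd (mor M v l) = snd (mor M v l')"
    if "v \<in> comps M" "v \<noteq> v0" "l \<in> P1" "l' \<in> P1" for v l l'
    using flag_morphism_snd_const[of "e1 v" "mor M v" l l'] bspec[OF e(1), of v] v0(3)[of v] that by simp
  have "\<exists>l0\<in>P1. snd (ev k M) = snd (mor M v0 l0)" if "k \<in> {1, 2}" for k
    unfolding ev_def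
    by (rule prestable_image_on_component[where h = snd,
          OF Mbar_prestable[OF assms] v0(1) _ Mbar_mark[OF assms that]]) (rule const)
  from this[of 1] this[of 2] obtain l l' where l: "l \<in> P1" "l' \<in> P1"
    "snd (ev 1 M) = snd (mor M v0 l)" "snd (ev 2 M) = snd (mor M v0 l')"
    by auto
  have "flag_morphism (e1 v0) 1 (mor M v0)" using e(1) v0(1,2) by force
  from flag_morphism_snd_meet[OF this l(1,2)] show ?thesis unfolding l(3,4) .
qed


section \<open>Gluing stable maps\<close>

text \<open>The two-point relation behind curve neighborhoods: for nonzero \<open>d\<close>,
  \<open>curve_nbhd d \<Omega>\<close> is the image of \<open>\<Omega>\<close> under it.\<close>

definition joined :: "nat \<times> nat \<Rightarrow> 'm::{finite,linorder} flag \<Rightarrow> 'm flag \<Rightarrow> bool" where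
  "joined d F G \<longleftrightarrow> (\<exists>M\<in>Mbar d. ev 1 M = F \<and> ev 2 M = G)"

text \<open>Even numbers label the components of \<open>M\<close> and odd ones those of
  \<open>N\<close>, which keeps them disjoint. The second mark of \<open>M\<close> and the first
  mark of \<open>N\<close> become the two sides of a new node; the other two marks survive.\<close>

definition glue ::
    "'m::{finite,linorder} pointed_map \<Rightarrow> 'm pointed_map \<Rightarrow> 'm pointed_map" where
  "glue M N = \<lparr>
     comps = (\<lambda>v. 2 * v) ` comps M \<union> (\<lambda>v. 2 * v + 1) ` comps N,
     adj = map_prod (\<lambda>v. 2 * v) (\<lambda>v. 2 * v) ` adj M \<union>
       map_prod (\<lambda>v. 2 * v + 1) (\<lambda>v. 2 * v + 1) ` adj N \<union>
       {(2 * fst (mark M 2), 2 * fst (mark N 1) + 1), (2 * fst (mark N 1) + 1, 2 * fst (mark M 2))},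
     node = (\<lambda>v w. if even v
       then if even w then node M (v div 2) (w div 2) else snd (mark M 2)
       else if odd w then node N (v div 2) (w div 2) else snd (mark N 1)),
     mark = (\<lambda>k. if k = 1 then (2 * fst (mark M 1), snd (mark M 1))
       else (2 * fst (mark N 2) + 1, snd (mark N 2))),
     mor = (\<lambda>v. if even v then mor M (v div 2) else mor N (v div 2))\<rparr>"

lemma marks_on_eq:
  "marks_on M v = (if fst (mark M 1) = v then {snd (mark M 1)} else {}) \<union>
     (if fst (mark M 2) = v then {snd (mark M 2)} else {})"
  by (auto simp: marks_on_def)

lemma double_eq_iffs:
  "2 * v \<noteq> 2 * w + (1::nat)" "2 * v + (1::nat) \<noteq> 2 * w" "2 * v \<noteq> Suc (2 * w)" "Suc (2 * v) \<noteq> 2 * w"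
  by presburger+

lemma glue_neighbours:
  "adj (glue M N) `` {2 * v} = (\<lambda>w. 2 * w) ` (adj M `` {v}) \<union>
     (if v = fst (mark M 2) then {2 * fst (mark N 1) + 1} else {})"
  "adj (glue M N) `` {2 * v + 1} = (\<lambda>w. 2 * w + 1) ` (adj N `` {v}) \<union>
     (if v = fst (mark N 1) then {2 * fst (mark M 2)} else {})"
  by (auto simp: glue_def double_eq_iffs image_iff)

lemma glue_node:
  "node (glue M N) (2 * v) (2 * w) = node M v w"
  "node (glue M N) (2 * v) (2 * w + 1) = snd (mark M 2)"
  "node (glue M N) (2 * v + 1) (2 * w + 1) = node N v w"
  "node (glue M N) (2 * v + 1) (2 * w) = snd (mark N 1)"
  by (simp_all add: glue_def)

lemma glue_nodes_on:
  "nodes_on (glue M N) (2 * v) = nodes_on M v \<union> (if v = fst (mark M 2) then {snd (mark M 2)} else {})"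
  "nodes_on (glue M N) (2 * v + 1) = nodes_on N v \<union> (if v = fst (mark N 1) then {snd (mark N 1)} else {})"
  unfolding nodes_on_def glue_neighbours image_Un image_image glue_node
  by (simp_all add: glue_node del: One_nat_def add_Suc_right)

lemma glue_marks_on:
  "marks_on (glue M N) (2 * v) = (if v = fst (mark M 1) then {snd (mark M 1)} else {})"
  "marks_on (glue M N) (2 * v + 1) = (if v = fst (mark N 2) then {snd (mark N 2)} else {})"
  unfolding marks_on_eq by (auto simp: glue_def double_eq_iffs)

text \<open>A mark used for gluing turns into a node at the same point, so no component gains or
  loses special points. Stability is therefore inherited.\<close>

lemma glue_special_points:
  "nodes_on (glue M N) (2 * v) \<union> marks_on (glue M N) (2 * v) = nodes_on M v \<union> marks_on M v"
  "nodes_on (glue M N) (2 * v + 1) \<union> marks_on (glue M N) (2 * v + 1) = nodes_on N v \<union> marks_on N v"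
  unfolding glue_nodes_on glue_marks_on unfolding marks_on_eq by auto

lemma rtrancl_monotone_map:
  assumes "(x, y) \<in> r\<^sup>*" and "\<And>x y. (x, y) \<in> r \<Longrightarrow> (f x, f y) \<in> s"
  shows "(f x, f y) \<in> s\<^sup>*"
  using assms(1) by induction (auto intro: rtrancl_into_rtrancl assms(2))

text \<open>Joining two trees by one edge gives a tree: the new edge counts twice in
  \<open>adj\<close>, and \<open>2 * (m - 1) + 2 * (k - 1) + 2 = 2 * (m + k - 1)\<close>.\<close>

lemma genus0_glue:
  assumes M: "genus0_dual_graph M" "fst (mark M 2) \<in> comps M"
    and N: "genus0_dual_graph N" "fst (mark N 1) \<in> comps N"
  shows "genus0_dual_graph (glue M N)"
proof -
  let ?G = "glue M N" and ?p = "2 * fst (mark M 2)" and ?q = "2 * fst (mark N 1) + 1"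
  let ?e = "\<lambda>v::nat. 2 * v" and ?o = "\<lambda>v::nat. 2 * v + 1"
  note MN = M(1)[unfolded genus0_dual_graph_def] N(1)[unfolded genus0_dual_graph_def]
  have comps: "comps ?G = ?e ` comps M \<union> ?o ` comps N"
    and adj: "adj ?G = map_prod ?e ?e ` adj M \<union> map_prod ?o ?o ` adj N \<union> {(?p, ?q), (?q, ?p)}"
    by (simp_all add: glue_def)
  have fin: "finite (adj M)" "finite (adj N)"
    using MN by (meson finite_SigmaI finite_subset)+
  \<comment> \<open>Positivity makes the truncated subtractions in the edge count genuine.\<close>
  have card_pos: "card (comps M) > 0" "card (comps N) > 0" using MN by (auto simp: card_gt_0_iff)
  have "card (comps ?G) = card (comps M) + card (comps N)"
    unfolding comps using MN
    by (subst card_Un_disjoint) (auto simp: card_image inj_on_def double_eq_iffs)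
  moreover have "card (adj ?G) = card (adj M) + card (adj N) + 2"
  proof -
    have "card (map_prod ?e ?e ` adj M \<union> map_prod ?o ?o ` adj N) = card (adj M) + card (adj N)"
    proof -
      have "inj (map_prod ?e ?e)" "inj (map_prod ?o ?o)" by (auto intro!: prod.inj_map injI)
      then have "card (map_prod ?e ?e ` adj M) = card (adj M)"
        "card (map_prod ?o ?o ` adj N) = card (adj N)" by (metis card_image inj_on_subset subset_UNIV)+
      moreover have "map_prod ?e ?e ` adj M \<inter> map_prod ?o ?o ` adj N = {}"
        by (auto simp: double_eq_iffs)
      ultimately show ?thesis using fin by (simp add: card_Un_disjoint)
    qed
    moreover have "(map_prod ?e ?e ` adj M \<union> map_prod ?o ?o ` adj N) \<inter> {(?p, ?q), (?q, ?p)} = {}"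
      by (auto simp: double_eq_iffs)
    moreover have "card {(?p, ?q), (?q, ?p)} = 2" by (simp add: double_eq_iffs)
    ultimately show ?thesis unfolding adj using fin by (subst card_Un_disjoint) auto
  qed
  ultimately have card: "card (adj ?G) = 2 * (card (comps ?G) - 1)"
    using MN card_pos by simp
  have even_conn: "(?e v, ?e w) \<in> (adj ?G)\<^sup>*" if "v \<in> comps M" "w \<in> comps M" for v w
  proof -
    have "(v, w) \<in> (adj M)\<^sup>*" using MN that by blast
    then show ?thesis by (rule rtrancl_monotone_map[where f = ?e]) (auto simp: adj)
  qed
  have odd_conn: "(?o v, ?o w) \<in> (adj ?G)\<^sup>*" if "v \<in> comps N" "w \<in> comps N" for v w
  proof -
    have "(v, w) \<in> (adj N)\<^sup>*" using MN that by blast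
    then show ?thesis by (rule rtrancl_monotone_map[where f = ?o]) (auto simp: adj)
  qed
  have bridge: "(?p, ?q) \<in> (adj ?G)\<^sup>*" "(?q, ?p) \<in> (adj ?G)\<^sup>*" by (auto simp: adj)
  have "(v, w) \<in> (adj ?G)\<^sup>*" if "v \<in> comps ?G" "w \<in> comps ?G" for v w
  proof -
    \<comment> \<open>It is enough to connect every component, in both directions, with the end
      \<open>?p\<close> of the bridge.\<close>
    have to_p: "(x, ?p) \<in> (adj ?G)\<^sup>* \<and> (?p, x) \<in> (adj ?G)\<^sup>*" if "x \<in> comps ?G" for x
      using that even_conn odd_conn bridge M(2) N(2) unfolding comps
      by (elim UnE imageE) (blast intro: rtrancl_trans)+
    show ?thesis using to_p[OF that(1)] to_p[OF that(2)] by (blast intro: rtrancl_trans)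
  qed
  moreover have "sym (adj ?G)" unfolding adj using MN by (auto simp: sym_def)
  moreover have "irrefl (adj ?G)" unfolding adj using MN by (auto simp: irrefl_def double_eq_iffs)
  moreover have "adj ?G \<subseteq> comps ?G \<times> comps ?G" unfolding adj comps using MN M(2) N(2) by auto
  moreover have "finite (comps ?G)" "comps ?G \<noteq> {}" unfolding comps using MN by auto
  ultimately show ?thesis using card unfolding genus0_dual_graph_def by blast
qed

lemma glue_comps_cases:
  assumes "v \<in> comps (glue M N)"
  obtains u where "v = 2 * u" "u \<in> comps M" | u where "v = 2 * u + 1" "u \<in> comps N"
  using assms by (auto simp: glue_def)

lemma prestable_glue:
  assumes M: "prestable M" and N: "prestable N" and ev: "ev 2 M = ev 1 N"
  shows "prestable (glue M N)"
proof -
  let ?G = "glue M N"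
  note M' = M[unfolded prestable_def] and N' = N[unfolded prestable_def]
  have nodes_P1: "nodes_on ?G v \<subseteq> P1" if "v \<in> comps ?G" for v
    using that
  proof (cases rule: glue_comps_cases)
    case (1 u)
    then show ?thesis using M' unfolding 1 glue_nodes_on by auto
  next
    case (2 u)
    then show ?thesis using N' unfolding 2 glue_nodes_on by auto
  qed
  have inj: "inj_on (node ?G v) (adj ?G `` {v})" if "v \<in> comps ?G" for v
    using that
  proof (cases rule: glue_comps_cases)
    case (1 u)
    have "inj_on (node M u) (adj M `` {u})" using M' 1 by auto
    \<comment> \<open>The new node is a former mark, and marks avoid nodes, so it differs from the
      old nodes of this component.\<close>
    moreover have "snd (mark M 2) \<notin> node M u ` (adj M `` {u})" if "u = fst (mark M 2)"
      using M' 1(2) that unfolding marks_on_eq nodes_on_def by auto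
    ultimately show ?thesis unfolding 1 glue_neighbours
      by (auto simp: glue_def inj_on_def)
  next
    case (2 u)
    have "inj_on (node N u) (adj N `` {u})" using N' 2 by auto
    moreover have "snd (mark N 1) \<notin> node N u ` (adj N `` {u})" if "u = fst (mark N 1)"
      using N' 2(2) that unfolding marks_on_eq nodes_on_def by auto
    ultimately show ?thesis unfolding 2 glue_neighbours
      by (auto simp: glue_def inj_on_def)
  qed
  have disj: "marks_on ?G v \<inter> nodes_on ?G v = {}" if "v \<in> comps ?G" for v
    using that
  proof (cases rule: glue_comps_cases)
    case (1 u)
    \<comment> \<open>The surviving mark must also avoid the new node, which holds because the two
      marks of \<open>M\<close> are distinct.\<close>
    have "marks_on M u \<inter> nodes_on M u = {}" "mark M 1 \<noteq> mark M 2" using M' 1 by auto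
    then show ?thesis unfolding 1 glue_nodes_on glue_marks_on unfolding marks_on_eq
      by (auto simp: prod_eq_iff)
  next
    case (2 u)
    have "marks_on N u \<inter> nodes_on N u = {}" "mark N 1 \<noteq> mark N 2" using N' 2 by auto
    then show ?thesis unfolding 2 glue_nodes_on glue_marks_on unfolding marks_on_eq
      by (auto simp: prod_eq_iff)
  qed
  have marks: "fst (mark ?G k) \<in> comps ?G \<and> snd (mark ?G k) \<in> P1" if "k \<in> {1, 2}" for k
    using that M' N' by (auto simp: glue_def)
  have neq: "mark ?G 1 \<noteq> mark ?G 2" by (simp add: glue_def double_eq_iffs)
  have "mor ?G v (node ?G v w) = mor ?G w (node ?G w v)" if "(v, w) \<in> adj ?G" for v w
  proof -
    have M_adj: "mor M v (node M v w) = mor M w (node M w v)" if "(v, w) \<in> adj M" for v w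
      using M' that by auto
    have N_adj: "mor N v (node N v w) = mor N w (node N w v)" if "(v, w) \<in> adj N" for v w
      using N' that by auto
    from that show ?thesis using ev M_adj N_adj by (auto simp: glue_def ev_def)
  qed
  then show ?thesis
    using genus0_glue[of M N] M' N' nodes_P1 inj disj marks neq unfolding prestable_def by auto
qed

lemma has_degree_glue:
  assumes "has_degree M (d1, d2)" "has_degree N (e1, e2)"
    and fin: "finite (comps M)" "finite (comps N)"
  shows "has_degree (glue M N) (d1 + e1, d2 + e2)"
proof -
  obtain a1 a2 where a: "\<forall>v\<in>comps M. flag_morphism (a1 v) (a2 v) (mor M v)"
    "d1 = sum a1 (comps M)" "d2 = sum a2 (comps M)"
    using assms(1) unfolding has_degree_def by auto
  obtain b1 b2 where b: "\<forall>v\<in>comps N. flag_morphism (b1 v) (b2 v) (mor N v)"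
    "e1 = sum b1 (comps N)" "e2 = sum b2 (comps N)"
    using assms(2) unfolding has_degree_def by auto
  define merge :: "(nat \<Rightarrow> nat) \<Rightarrow> (nat \<Rightarrow> nat) \<Rightarrow> nat \<Rightarrow> nat"
    where "merge f g v = (if even v then f (v div 2) else g (v div 2))" for f g v
  have merge_sum: "sum (merge f g) (comps (glue M N)) = sum f (comps M) + sum g (comps N)" for f g
  proof -
    have "sum (merge f g) (comps (glue M N)) =
        sum (merge f g) ((\<lambda>v. 2 * v) ` comps M) + sum (merge f g) ((\<lambda>v. 2 * v + 1) ` comps N)"
      using fin by (subst sum.union_disjoint[symmetric]) (auto simp: glue_def double_eq_iffs)
    also have "sum (merge f g) ((\<lambda>v. 2 * v) ` comps M) = sum f (comps M)"
      by (subst sum.reindex) (auto simp: inj_on_def merge_def)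
    also have "sum (merge f g) ((\<lambda>v. 2 * v + 1) ` comps N) = sum g (comps N)"
      by (subst sum.reindex) (auto simp: inj_on_def merge_def)
    finally show ?thesis .
  qed
  have "flag_morphism (merge a1 b1 v) (merge a2 b2 v) (mor (glue M N) v)" if "v \<in> comps (glue M N)" for v
    using that
  proof (cases rule: glue_comps_cases)
    case (1 u)
    then show ?thesis using a(1) by (simp add: merge_def glue_def)
  next
    case (2 u)
    then show ?thesis using b(1) by (simp add: merge_def glue_def)
  qed
  moreover have "(d1 + e1, d2 + e2) =
      (sum (merge a1 b1) (comps (glue M N)), sum (merge a2 b2) (comps (glue M N)))"
    by (simp add: merge_sum a b)
  ultimately show ?thesis unfolding has_degree_def by blast
qed

lemma stable_glue:
  assumes "stable M" "stable N"
  shows "stable (glue M N)"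
  unfolding stable_def
proof (intro ballI impI)
  fix v assume "v \<in> comps (glue M N)" and contr: "contracted (glue M N) v"
  then show "card (nodes_on (glue M N) v \<union> marks_on (glue M N) v) \<ge> 3"
  proof (cases rule: glue_comps_cases)
    case (1 u)
    have "contracted M u" using contr unfolding 1 contracted_def by (simp add: glue_def)
    then show ?thesis using assms(1) 1(2) unfolding 1 glue_special_points stable_def by blast
  next
    case (2 u)
    have "contracted N u" using contr unfolding 2 contracted_def by (simp add: glue_def)
    then show ?thesis using assms(2) 2(2) unfolding 2 glue_special_points stable_def by blast
  qed
qed

text \<open>Gluing at the common flag \<open>G\<close> adds degrees. This reduces the construction
  of curves to a few basic ones.\<close>

lemma joined_trans:
  assumes "joined (d1, d2) F G" "joined (e1, e2) G H"
  shows "joined (d1 + e1, d2 + e2) F H"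
proof -
  obtain M where M: "M \<in> Mbar (d1, d2)" "ev 1 M = F" "ev 2 M = G"
    using assms(1) unfolding joined_def by blast
  obtain N where N: "N \<in> Mbar (e1, e2)" "ev 1 N = G" "ev 2 N = H"
    using assms(2) unfolding joined_def by blast
  have "glue M N \<in> Mbar (d1 + e1, d2 + e2)"
    using M N prestable_glue[of M N] stable_glue[of M N] has_degree_glue[of M d1 d2 N e1 e2]
    by (auto simp: Mbar_def prestable_def genus0_dual_graph_def)
  moreover have "ev 1 (glue M N) = F" "ev 2 (glue M N) = H"
    using M(2) N(3) by (simp_all add: ev_def glue_def)
  ultimately show ?thesis unfolding joined_def by blast
qed

text \<open>That the two values differ is used twice: the marked points are distinct, and the only
  component is not contracted, which makes the map stable.\<close>

lemma joined_irreducible: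
  assumes \<phi>: "flag_morphism d1 d2 \<phi>" and l: "l \<in> P1" "l' \<in> P1" and neq: "\<phi> l \<noteq> \<phi> l'"
  shows "joined (d1, d2) (\<phi> l) (\<phi> l')"
proof -
  define M where "M = \<lparr>comps = {0}, adj = {}, node = (\<lambda>_ _. l),
    mark = (\<lambda>k. if k = 1 then (0, l) else (0, l')), mor = (\<lambda>_. \<phi>)\<rparr>"
  have "l \<noteq> l'" using neq by auto
  then have "prestable M"
    using l by (auto simp: M_def prestable_def genus0_dual_graph_def nodes_on_def sym_def irrefl_def)
  moreover have "has_degree M (d1, d2)"
    unfolding has_degree_def using \<phi> by (intro exI[of _ "\<lambda>_. d1"] exI[of _ "\<lambda>_. d2"]) (simp add: M_def)
  moreover have "\<not> contracted M 0"
    using l neq unfolding contracted_def M_def by (simp, metis)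
  then have "stable M" unfolding stable_def M_def by simp
  ultimately have "M \<in> Mbar (d1, d2)" by (simp add: Mbar_def)
  moreover have "ev 1 M = \<phi> l" "ev 2 M = \<phi> l'" by (simp_all add: ev_def M_def)
  ultimately show ?thesis unfolding joined_def by blast
qed


section \<open>Rational curves in the flag manifold\<close>

lemma span_singleton_neq:
  assumes "wedge x y \<noteq> 0"
  shows "vec.span {x} \<noteq> vec.span {y}"
  using assms wedge_eq_0_iff[of x y] vec.span_base[of y "{y}"] by auto

lemma span_singleton_eq:
  assumes "wedge x y = 0" "x \<noteq> 0" "y \<noteq> 0"
  shows "vec.span {x} = vec.span {y}"
proof -
  have "y \<in> vec.span {x}" using assms wedge_eq_0_iff by blast
  then show ?thesis
    using assms by (intro line_eq_span) (auto simp: dim_span_singleton simp del: vec.dim_span)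
qed

text \<open>Supplies three special points that stabilise a contracted component.\<close>

lemma three_points_on_P1:
  obtains p q r where "p \<in> P1" "q \<in> P1" "r \<in> P1" "p \<noteq> q" "q \<noteq> r" "p \<noteq> r"
proof -
  let ?x = "axis 1 1 :: complex^2" and ?y = "axis 2 1 :: complex^2"
  have "wedge ?x ?y $ (1, 2) \<noteq> 0" by (simp add: wedge_def axis_def)
  then have xy: "wedge ?x ?y \<noteq> 0" by (metis zero_index)
  have yx: "wedge ?y ?x \<noteq> 0" using xy by (simp add: wedge_commute[of ?y])
  let ?p = "vec.span {?x}" and ?q = "vec.span {?y}" and ?r = "vec.span {?x + ?y}"
  have "?x \<noteq> 0" "?y \<noteq> 0" "?x + ?y \<noteq> 0"
    using xy wedge_add_right[of ?x ?x ?y] by auto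
  then have "?p \<in> P1" "?q \<in> P1" "?r \<in> P1" unfolding P1_iff by blast+
  moreover have "?p \<noteq> ?q" "?q \<noteq> ?r" "?p \<noteq> ?r"
    using xy yx by (auto intro!: span_singleton_neq simp: wedge_add_right)
  ultimately show thesis by (rule that)
qed

lemma flag_morphism_const:
  assumes "F \<in> IF12"
  shows "flag_morphism 0 0 (\<lambda>_. F)"
proof -
  note F = IF12_D[OF assms]
  obtain x where x: "x \<noteq> 0" "fst F = vec.span {x}" using IF12_line[OF assms] by blast
  obtain u v where uv: "wedge u v \<noteq> 0" "snd F = vec.span {u, v}" using plane_basis[OF F(3,4)] .
  have "proj_morphism 0 (\<lambda>_. fst F)" unfolding proj_morphism_def
    using x by (intro exI[of _ "\<lambda>_. x"]) (simp add: binary_form_def)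
  moreover have "proj_morphism 0 (\<lambda>_. pluecker (snd F))" unfolding proj_morphism_def
    using uv by (intro exI[of _ "\<lambda>_. wedge u v"]) (simp add: binary_form_def pluecker_span)
  ultimately show ?thesis unfolding flag_morphism_def using assms by simp
qed

text \<open>
  Two marked points on an irreducible curve are distinct, so both evaluations can be the same point
  only if the marks sit on an extra contracted component.
\<close>

lemma joined_self:
  assumes \<phi>: "flag_morphism d1 d2 \<phi>" and l: "l \<in> P1" "l' \<in> P1" and neq: "\<phi> l \<noteq> \<phi> l'"
  shows "joined (d1, d2) (\<phi> l) (\<phi> l)"
proof -
  obtain p q r where pqr: "p \<in> P1" "q \<in> P1" "r \<in> P1" "p \<noteq> q" "q \<noteq> r" "p \<noteq> r"
    using three_points_on_P1 .
  \<comment> \<open>The contracted component \<open>0\<close> carries the marks \<open>p\<close>,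
    \<open>q\<close> and the node \<open>r\<close>; component \<open>1\<close> carries the curve and
    is attached at \<open>l\<close>.\<close>
  define M where "M = \<lparr>comps = {0, 1}, adj = {(0, 1), (1, 0)},
    node = (\<lambda>v _. if v = 0 then r else l),
    mark = (\<lambda>k. if k = 1 then (0, p) else (0, q)),
    mor = (\<lambda>v. if v = 0 then (\<lambda>_. \<phi> l) else \<phi>)\<rparr>"
  have nodes: "nodes_on M 0 = {r}" "nodes_on M 1 = {l}" by (auto simp: nodes_on_def M_def)
  have marks: "marks_on M 0 = {p, q}" "marks_on M 1 = {}" unfolding marks_on_eq by (auto simp: M_def)
  have conn: "(v, w) \<in> (adj M)\<^sup>*" if "v \<in> {0, 1}" "w \<in> {0, 1}" for v w
    using that by (auto simp: M_def)
  have comps: "comps M = {0, 1}" by (simp add: M_def)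
  have "genus0_dual_graph M" unfolding genus0_dual_graph_def
    using conn by (auto simp: M_def sym_def irrefl_def)
  moreover have "\<forall>v\<in>comps M. inj_on (node M v) (adj M `` {v})"
    by (auto simp: M_def inj_on_def)
  moreover have "\<forall>v\<in>comps M. nodes_on M v \<subseteq> P1 \<and> marks_on M v \<inter> nodes_on M v = {}"
    using nodes marks pqr l by (auto simp: comps)
  moreover have "\<forall>(v, w)\<in>adj M. mor M v (node M v w) = mor M w (node M w v)"
    by (auto simp: M_def)
  moreover have "\<forall>k\<in>{1, 2}. fst (mark M k) \<in> comps M \<and> snd (mark M k) \<in> P1" "mark M 1 \<noteq> mark M 2"
    using pqr by (auto simp: M_def)
  ultimately have "prestable M" unfolding prestable_def by blast
  moreover have "has_degree M (d1, d2)"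
  proof -
    have "flag_morphism 0 0 (\<lambda>_. \<phi> l)"
      using \<phi> l(1) by (intro flag_morphism_const) (auto simp: flag_morphism_def)
    then show ?thesis unfolding has_degree_def using \<phi>
      by (intro exI[of _ "\<lambda>v. if v = 0 then 0 else d1"] exI[of _ "\<lambda>v. if v = 0 then 0 else d2"])
        (simp add: M_def)
  qed
  moreover have "stable M" unfolding stable_def
  proof (intro ballI impI)
    fix v assume v: "v \<in> comps M" and contr: "contracted M v"
    have "\<not> contracted M 1" unfolding contracted_def using l neq by (simp add: M_def) metis
    with v contr have "v = 0" by (auto simp: comps)
    moreover have "card {p, q, r} = 3" using pqr by auto
    ultimately show "card (nodes_on M v \<union> marks_on M v) \<ge> 3" using nodes marks by simp
  qed
  ultimately have "M \<in> Mbar (d1, d2)" by (simp add: Mbar_def)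
  moreover have "ev 1 M = \<phi> l" "ev 2 M = \<phi> l" by (simp_all add: ev_def M_def)
  ultimately show ?thesis unfolding joined_def by blast
qed

text \<open>The interface for all constructions below: a family of flags given by homogeneous
  formulas in a nonzero \<open>z\<close> yields stable maps. The second conclusion handles two equal
  flags.\<close>

lemma joined_curve:
  fixes F :: "complex^2 \<Rightarrow> 'm::{finite,linorder} flag"
  assumes IF: "\<And>z. z \<noteq> 0 \<Longrightarrow> F z \<in> IF12"
    and scale: "\<And>k z. k \<noteq> 0 \<Longrightarrow> z \<noteq> 0 \<Longrightarrow> F (k *s z) = F z"
    and line: "\<And>z. z \<noteq> 0 \<Longrightarrow> fst (F z) = vec.span {binary_form d1 c z}"
    and plane: "\<And>z. z \<noteq> 0 \<Longrightarrow> pluecker (snd (F z)) = vec.span {binary_form d2 e z}"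
    and zw: "z \<noteq> 0" "w \<noteq> 0" "F z \<noteq> F w"
  shows "joined (d1, d2) (F z) (F w)" "joined (d1, d2) (F z) (F z)"
proof -
  \<comment> \<open>Any representative of the point \<open>l\<close> may be chosen, since
    \<open>scale\<close> makes the flag independent of it.\<close>
  define \<phi> where "\<phi> l = F (SOME z. z \<noteq> 0 \<and> l = vec.span {z})" for l
  have \<phi>: "\<phi> (vec.span {z}) = F z" if "z \<noteq> 0" for z
  proof -
    define y where "y = (SOME y. y \<noteq> 0 \<and> vec.span {z} = vec.span {y})"
    have y: "y \<noteq> 0 \<and> vec.span {z} = vec.span {y}"
      unfolding y_def by (rule someI[of _ z]) (simp add: that)
    then have "y \<in> vec.span {z}" by (simp add: vec.span_base)
    then obtain k where k: "y = k *s z" by (auto simp: vec.span_singleton)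
    with y have "k \<noteq> 0" by auto
    have "\<phi> (vec.span {z}) = F y" unfolding \<phi>_def y_def ..
    also have "\<dots> = F z" unfolding k by (rule scale[OF \<open>k \<noteq> 0\<close> that])
    finally show ?thesis .
  qed
  \<comment> \<open>A common zero of the form would turn the line of the flag into the zero
    space.\<close>
  have nz1: "binary_form d1 c z \<noteq> 0" if "z \<noteq> 0" for z
    using IF12_D(2)[OF IF[OF that]] line[OF that] by auto
  have nz2: "binary_form d2 e z \<noteq> 0" if nonzero: "z \<noteq> 0" for z
  proof
    assume "binary_form d2 e z = 0"
    moreover obtain u v where "wedge u v \<noteq> 0" "snd (F z) = vec.span {u, v}"
      using plane_basis[OF IF12_D(3,4)[OF IF[OF nonzero]]] .
    ultimately show False
      using plane[OF nonzero] vec.span_base[of "wedge u v" "{wedge u v}"] by (simp add: pluecker_span)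
  qed
  have "flag_morphism d1 d2 \<phi>" unfolding flag_morphism_def proj_morphism_def
  proof (intro conjI ballI exI allI impI)
    show "\<phi> l \<in> IF12" if "l \<in> P1" for l using that IF \<phi> unfolding P1_iff by auto
  qed (use \<phi> line plane nz1 nz2 in auto)
  moreover have "vec.span {z} \<in> P1" "vec.span {w} \<in> P1" using zw by (auto simp: P1_iff)
  ultimately show "joined (d1, d2) (F z) (F w)" "joined (d1, d2) (F z) (F z)"
    using joined_irreducible[of d1 d2 \<phi>] joined_self[of d1 d2 \<phi>] \<phi> zw by metis+
qed

text \<open>The line through \<open>x\<close> and \<open>y\<close>, parametrised by a map of degree
  \<open>d\<close>; the powers give curves of every positive degree from one formula.\<close>

definition pencil :: "nat \<Rightarrow> complex^'k \<Rightarrow> complex^'k \<Rightarrow> complex^2 \<Rightarrow> complex^'k" where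
  "pencil d x y z = (z $ 1) ^ d *s x + (z $ 2) ^ d *s y"

text \<open>Written as a sum so that for \<open>d = 0\<close>, where both terms fall on the same
  coefficient, the form is still \<open>pencil\<close>.\<close>

definition pencil_coeff :: "nat \<Rightarrow> complex^'k \<Rightarrow> complex^'k \<Rightarrow> nat \<Rightarrow> complex^'k" where
  "pencil_coeff d x y i = (if i = d then x else 0) + (if i = 0 then y else 0)"

lemma binary_form_pencil: "binary_form d (pencil_coeff d x y) z = pencil d x y z"
proof -
  have "binary_form d (pencil_coeff d x y) z =
      (\<Sum>i\<le>d. if i = d then (z $ 1) ^ d *s x else 0) + (\<Sum>i\<le>d. if i = 0 then (z $ 2) ^ d *s y else 0)"
    unfolding binary_form_def pencil_coeff_def sum.distrib[symmetric]
    by (intro sum.cong) (auto simp: vec.scale_right_distrib)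
  then show ?thesis by (simp add: pencil_def)
qed

lemma pencil_scale: "pencil d x y (k *s z) = k ^ d *s pencil d x y z"
  by (simp add: pencil_def vec.scale_right_distrib power_mult_distrib mult.assoc)

lemma pencil_axis:
  assumes "d > 0"
  shows "pencil d x y (axis 1 1) = x" "pencil d x y (axis 2 1) = y"
  using assms by (simp_all add: pencil_def axis_def)

lemma wedge_pencil_right: "wedge x (pencil d u v z) = pencil d (wedge x u) (wedge x v) z"
  by (simp add: pencil_def wedge_simps)

lemma omega_pencil_right: "omega x (pencil d u v z) = (z $ 1) ^ d * omega x u + (z $ 2) ^ d * omega x v"
  by (simp add: pencil_def omega_simps)

lemma nonzero_2_iff: "(z :: complex^2) \<noteq> 0 \<longleftrightarrow> z $ 1 \<noteq> 0 \<or> z $ 2 \<noteq> 0"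
  by (simp add: vec_eq_iff forall_2)

text \<open>Wedging the pencil with \<open>y\<close> and with \<open>x\<close> isolates its two
  coefficients.\<close>

lemma pencil_nonzero:
  assumes "x \<noteq> 0" "y \<noteq> 0" "vec.span {x} \<noteq> vec.span {y}" "z \<noteq> 0"
  shows "pencil d x y z \<noteq> 0"
proof
  assume 0: "pencil d x y z = 0"
  have "wedge x y \<noteq> 0" using assms span_singleton_eq by blast
  moreover have "wedge (pencil d x y z) y = (z $ 1) ^ d *s wedge x y"
    "wedge x (pencil d x y z) = (z $ 2) ^ d *s wedge x y"
    by (simp_all add: pencil_def wedge_simps)
  ultimately have "z $ 1 = 0 \<and> z $ 2 = 0" using 0 by auto
  with assms(4) nonzero_2_iff show False by blast
qed

section \<open>Joining flags by curves of given degree\<close>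

lemma axis_2_nonzero: "(axis 1 1 :: complex^2) \<noteq> 0" "(axis 2 1 :: complex^2) \<noteq> 0"
  by (simp_all add: axis_eq_0_iff)

lemma joined_lines_in_plane:
  fixes F G :: "'m::{finite,linorder} flag"
  assumes F: "F \<in> IF12" and G: "G \<in> IF12" and eq: "snd F = snd G" and neq: "F \<noteq> G" and d: "d > 0"
  shows "joined (d, 0) F G" "joined (d, 0) F F"
proof -
  obtain x where x: "x \<noteq> 0" "fst F = vec.span {x}" "x \<in> snd F" using IF12_line[OF F] .
  obtain y where y: "y \<noteq> 0" "fst G = vec.span {y}" "y \<in> snd G" using IF12_line[OF G] .
  have xy: "vec.span {x} \<noteq> vec.span {y}" using neq eq x y by (auto simp: prod_eq_iff)
  obtain u v where uv: "snd F = vec.span {u, v}" using plane_basis[OF IF12_D(3,4)[OF F]] .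
  let ?F = "\<lambda>z. (vec.span {pencil d x y z}, snd F)"
  have "?F z \<in> IF12" if "z \<noteq> 0" for z
    using pencil_nonzero[OF x(1) y(1) xy that] x(3) y(3) eq IF12_D(3)[OF F]
    by (intro line_in_flag_in_IF12[OF F]) (auto simp: pencil_def vec.subspace_add vec.subspace_scale)
  moreover have "?F (k *s z) = ?F z" if "k \<noteq> 0" for k z
    using that by (simp add: pencil_scale span_scale_generator)
  moreover have "?F (axis 1 1) = F" "?F (axis 2 1) = G"
    using x(2) y(2) eq d by (simp_all add: pencil_axis prod_eq_iff)
  moreover have "pluecker (snd (?F z)) = vec.span {binary_form 0 (\<lambda>_. wedge u v) z}" for z
    by (simp add: uv pluecker_span binary_form_def)
  ultimately show "joined (d, 0) F G" "joined (d, 0) F F"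
    using joined_curve[of ?F d "pencil_coeff d x y" 0 "\<lambda>_. wedge u v" "axis 1 1" "axis 2 1"]
      axis_2_nonzero neq
    by (simp_all add: binary_form_pencil)
qed

text \<open>For \<open>F = G\<close> a second line in the plane provides a nonconstant curve through
  \<open>F\<close>, to which a contracted component is attached.\<close>

lemma joined_same_plane:
  fixes F G :: "'m::{finite,linorder} flag"
  assumes "F \<in> IF12" "G \<in> IF12" "snd F = snd G" "d > 0"
  shows "joined (d, 0) F G"
proof (cases "F = G")
  case True
  obtain x where x: "x \<noteq> 0" "fst F = vec.span {x}" "x \<in> snd F" using IF12_line[OF assms(1)] .
  obtain u where u: "wedge x u \<noteq> 0" "u \<in> snd F"
    using IF12_adapted_basis[OF assms(1) x(3,1)] by blast
  let ?H = "(vec.span {u}, snd F)"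
  have "u \<noteq> 0" using u by auto
  then have "?H \<in> IF12" by (rule line_in_flag_in_IF12[OF assms(1) u(2)])
  moreover have "F \<noteq> ?H" using x(2) span_singleton_neq[OF u(1)] by (auto simp: prod_eq_iff)
  ultimately show ?thesis using joined_lines_in_plane(2)[OF assms(1) _ _ _ assms(4)] True by simp
qed (use assms joined_lines_in_plane in blast)

text \<open>With the line spanned by \<open>x\<close> fixed, the moving plane has Pluecker vector in
  the pencil of \<open>wedge x u\<close> and \<open>wedge x v\<close>; these are independent because
  the planes differ.\<close>

lemma joined_planes_through_line:
  fixes F G :: "'m::{finite,linorder} flag"
  assumes F: "F \<in> IF12" and G: "G \<in> IF12" and eq: "fst F = fst G" and neq: "F \<noteq> G" and d: "d > 0"
  shows "joined (0, d) F G" "joined (0, d) F F"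
proof -
  obtain x where x: "x \<noteq> 0" "fst F = vec.span {x}" "x \<in> snd F" using IF12_line[OF F] .
  have "x \<in> snd G" using eq x(2) IF12_D(6)[OF G] by (auto intro: vec.span_base)
  obtain u where u: "wedge x u \<noteq> 0" "omega x u = 0" "snd F = vec.span {x, u}"
    using IF12_adapted_basis[OF F x(3,1)] by blast
  obtain v where v: "wedge x v \<noteq> 0" "omega x v = 0" "snd G = vec.span {x, v}"
    using IF12_adapted_basis[OF G \<open>x \<in> snd G\<close> x(1)] by blast
  have "pluecker (snd F) \<noteq> pluecker (snd G)"
    using pluecker_inj[OF IF12_D(3,4)[OF F] IF12_D(3,4)[OF G]] neq eq by (auto simp: prod_eq_iff)
  then have uv: "vec.span {wedge x u} \<noteq> vec.span {wedge x v}" by (simp add: u v pluecker_span)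
  let ?F = "\<lambda>z. (vec.span {x}, vec.span {x, pencil d u v z})"
  have "?F z \<in> IF12" if "z \<noteq> 0" for z
    using pencil_nonzero[OF u(1) v(1) uv that] u(2) v(2)
    by (intro span_flag_in_IF12) (simp_all add: wedge_pencil_right omega_pencil_right)
  moreover have "?F (k *s z) = ?F z" if "k \<noteq> 0" for k z
    using that span_scale_generators[of 1 "k ^ d" x] by (simp add: pencil_scale)
  moreover have "?F (axis 1 1) = F" "?F (axis 2 1) = G"
    using x(2) u(3) v(3) eq d by (simp_all add: pencil_axis prod_eq_iff)
  moreover have "fst (?F z) = vec.span {binary_form 0 (\<lambda>_. x) z}" for z
    by (simp add: binary_form_def)
  ultimately show "joined (0, d) F G" "joined (0, d) F F"
    using joined_curve[of ?F 0 "\<lambda>_. x" d "pencil_coeff d (wedge x u) (wedge x v)" "axis 1 1" "axis 2 1"]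
      axis_2_nonzero neq
    by (simp_all add: binary_form_pencil pluecker_span wedge_pencil_right)
qed

lemma exists_vector_outside:
  fixes S :: "'m::finite evec set"
  assumes "vec.dim S < CARD('m)"
  obtains v where "v \<notin> vec.span S"
proof -
  have "vec.span S \<noteq> UNIV"
    using assms by (metis less_irrefl vec.dim_span vec.dim_UNIV card_cart_basis)
  then show thesis using that by blast
qed

text \<open>The condition \<open>omega x v = 0\<close> costs at most one dimension, and
  \<open>E\<close> has at least two dimensions modulo \<open>snd F\<close>, so some admissible
  \<open>v\<close> lies outside the plane.\<close>

lemma exists_other_plane_through_line:
  fixes F :: "'m::{finite,linorder} flag"
  assumes F: "F \<in> IF12" and "CARD('m) > 3"
  obtains G where "G \<in> IF12" "fst G = fst F" "G \<noteq> F"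
proof -
  obtain x where x: "x \<noteq> 0" "fst F = vec.span {x}" "x \<in> snd F" using IF12_line[OF F] .
  have span_F: "vec.span (snd F) = snd F" using IF12_D(3)[OF F] by simp
  obtain w1 where w1: "w1 \<notin> snd F"
    using exists_vector_outside[of "snd F"] IF12_D(4)[OF F] assms(2) span_F by auto
  have "vec.dim (insert w1 (snd F)) = 3"
    using w1 IF12_D(4)[OF F] by (simp add: vec.dim_insert span_F)
  then obtain w2 where w2: "w2 \<notin> vec.span (insert w1 (snd F))"
    using exists_vector_outside[of "insert w1 (snd F)"] assms(2) by auto
  obtain v where v: "v \<notin> snd F" "omega x v = 0"
  proof (cases "omega x w1 = 0")
    case True
    then show thesis using that w1 by blast
  next
    case False
    \<comment> \<open>This multiple cancels \<open>omega x w2\<close>; the difference stays outside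
      \<open>snd F\<close> because \<open>w2\<close> is independent of \<open>w1\<close> modulo
      \<open>snd F\<close>.\<close>
    let ?k = "omega x w2 / omega x w1"
    have "w2 - ?k *s w1 \<notin> snd F"
      using w2 unfolding vec.span_insert span_F by blast
    moreover have "omega x (w2 - ?k *s w1) = 0"
      using False omega_add_right[of x "w2 - ?k *s w1" "?k *s w1"] by (simp add: omega_scale_right)
    ultimately show thesis by (rule that)
  qed
  have "v \<notin> vec.span {x}"
    using v(1) x(3) IF12_D(3)[OF F] vec.span_minimal[of "{x}" "snd F"] by auto
  then have "wedge x v \<noteq> 0" using x(1) by (simp add: wedge_eq_0_iff)
  then have "(vec.span {x}, vec.span {x, v}) \<in> IF12" using v(2) by (rule span_flag_in_IF12)
  moreover have "v \<in> vec.span {x, v}" by (simp add: vec.span_base)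
  ultimately show thesis
    using v(1) x(2) by (intro that[of "(vec.span {x}, vec.span {x, v})"]) auto
qed

lemma joined_same_line:
  fixes F G :: "'m::{finite,linorder} flag"
  assumes "F \<in> IF12" "G \<in> IF12" "fst F = fst G" "d > 0" and "CARD('m) > 3"
  shows "joined (0, d) F G"
proof (cases "F = G")
  case True
  obtain H where H: "H \<in> IF12" "fst H = fst F" "H \<noteq> F"
    using exists_other_plane_through_line[OF assms(1,5)] .
  then show ?thesis using joined_planes_through_line(2)[OF assms(1) H(1)] True assms(4) by simp
qed (use assms joined_planes_through_line in blast)

text \<open>Excess degree is absorbed by gluing on curves that lead from \<open>G\<close> back to
  \<open>G\<close>, one for each coordinate.\<close>

lemma joined_increase_degree:
  fixes F G :: "'m::{finite,linorder} flag"
  assumes FG: "joined (d1, d2) F G" and G: "G \<in> IF12" and le: "d1 \<le> e1" "d2 \<le> e2"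
    and "CARD('m) > 3"
  shows "joined (e1, e2) F G"
proof -
  have 1: "joined (e1, d2) F G"
  proof (cases "e1 = d1")
    case False
    with le have "joined (e1 - d1, 0) G G" by (intro joined_same_plane G) auto
    from joined_trans[OF FG this] le show ?thesis by simp
  qed (use FG in simp)
  show ?thesis
  proof (cases "e2 = d2")
    case False
    with le have "joined (0, e2 - d2) G G" by (intro joined_same_line G assms) auto
    from joined_trans[OF 1 this] le show ?thesis by simp
  qed (use 1 in simp)
qed

text \<open>Neither line being spanned by \<open>w\<close> lets the planes be written as
  \<open>span {w, u}\<close> and \<open>span {w, v}\<close>; the curve moves the line in the pencil
  of \<open>u\<close> and \<open>v\<close> and keeps \<open>w\<close> in the plane.\<close>

lemma joined_pencil:
  fixes F G :: "'m::{finite,linorder} flag"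
  assumes F: "F \<in> IF12" and G: "G \<in> IF12" and neq: "snd F \<noteq> snd G"
    and w: "w \<in> snd F" "w \<in> snd G" "w \<noteq> 0" "fst F \<noteq> vec.span {w}" "fst G \<noteq> vec.span {w}"
  shows "joined (1, 1) F G"
proof -
  obtain u where u: "u \<noteq> 0" "fst F = vec.span {u}" "u \<in> snd F" using IF12_line[OF F] .
  obtain v where v: "v \<noteq> 0" "fst G = vec.span {v}" "v \<in> snd G" using IF12_line[OF G] .
  have wedge: "wedge w u \<noteq> 0" "wedge w v \<noteq> 0"
    using span_singleton_eq[of w u] span_singleton_eq[of w v] u v w by auto
  have planes: "snd F = vec.span {w, u}" "snd G = vec.span {w, v}"
    using plane_eq_span[OF IF12_D(3,4)[OF F] w(1) u(3) wedge(1)]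
      plane_eq_span[OF IF12_D(3,4)[OF G] w(2) v(3) wedge(2)] .
  have omega: "omega w u = 0" "omega w v = 0"
    using IF12_D(5)[OF F] IF12_D(5)[OF G] u v w by (auto simp: isotropic_def)
  have uv: "vec.span {wedge w u} \<noteq> vec.span {wedge w v}"
    using pluecker_inj[OF IF12_D(3,4)[OF F] IF12_D(3,4)[OF G]] neq by (auto simp: planes pluecker_span)
  let ?F = "\<lambda>z. (vec.span {pencil 1 u v z}, vec.span {w, pencil 1 u v z})"
  have "?F z \<in> IF12" if "z \<noteq> 0" for z
  proof -
    let ?y = "pencil 1 u v z"
    have "wedge w ?y \<noteq> 0" "omega w ?y = 0"
      using pencil_nonzero[OF wedge uv that, of 1] omega
      by (simp_all add: wedge_pencil_right omega_pencil_right)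
    then have "wedge ?y w \<noteq> 0" "omega ?y w = 0"
      using wedge_commute[of ?y w] omega_skew[of ?y w] by simp_all
    from span_flag_in_IF12[OF this] show ?thesis by (simp add: insert_commute)
  qed
  moreover have "?F (k *s z) = ?F z" if "k \<noteq> 0" for k z
    using that span_scale_generators[of 1 "k ^ 1" w] span_scale_generator by (simp add: pencil_scale)
  moreover have "?F (axis 1 1) = F" "?F (axis 2 1) = G"
    using u(2) v(2) planes by (simp_all add: pencil_axis prod_eq_iff)
  moreover have "F \<noteq> G" using neq by auto
  ultimately show ?thesis
    using joined_curve(1)[of ?F 1 "pencil_coeff 1 u v" 1 "pencil_coeff 1 (wedge w u) (wedge w v)"
        "axis 1 1" "axis 2 1"] axis_2_nonzero
    by (simp add: binary_form_pencil pluecker_span wedge_pencil_right)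
qed

text \<open>If one of the lines is the common line \<open>w\<close>, the pencil degenerates and is
  replaced by two steps: one changes the plane with the line fixed at \<open>w\<close>, the other
  the line within its plane.\<close>

lemma joined_meeting_planes:
  fixes F G :: "'m::{finite,linorder} flag"
  assumes F: "F \<in> IF12" and G: "G \<in> IF12" and meet: "snd F \<inter> snd G \<noteq> {0}" and d: "d > 0"
    and card: "CARD('m) > 3"
  shows "joined (d, 1) F G"
proof (cases "snd F = snd G")
  case True
  then have "joined (d, 0) F G" using joined_same_plane[OF F G _ d] by simp
  then show ?thesis by (rule joined_increase_degree[OF _ G _ _ card]) auto
next
  case False
  have "0 \<in> snd F" "0 \<in> snd G" using IF12_D(3)[OF F] IF12_D(3)[OF G] by (auto simp: vec.subspace_0)
  then obtain w where w: "w \<in> snd F" "w \<in> snd G" "w \<noteq> 0" using meet by auto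
  have Fw: "(vec.span {w}, snd F) \<in> IF12" and Gw: "(vec.span {w}, snd G) \<in> IF12"
    using line_in_flag_in_IF12[OF F w(1,3)] line_in_flag_in_IF12[OF G w(2,3)] .
  show ?thesis
  proof (cases "fst F = vec.span {w}")
    case True
    have "joined (0, 1) F (vec.span {w}, snd G)" "joined (d, 0) (vec.span {w}, snd G) G"
      using joined_same_line[OF F Gw _ _ card] joined_same_plane[OF Gw G _ d] True by auto
    from joined_trans[OF this] show ?thesis by simp
  next
    case nF: False
    show ?thesis
    proof (cases "fst G = vec.span {w}")
      case True
      have "joined (d, 0) F (vec.span {w}, snd F)" "joined (0, 1) (vec.span {w}, snd F) G"
        using joined_same_line[OF Fw G _ _ card] joined_same_plane[OF F Fw _ d] True by auto
      from joined_trans[OF this] show ?thesis by simp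
    next
      case nG: False
      from joined_pencil[OF F G False w nF nG] show ?thesis
        by (rule joined_increase_degree[OF _ G _ _ card]) (use d in auto)
    qed
  qed
qed

text \<open>Both generators of the plane move linearly, so the line has degree 1 and the Pluecker
  vector is a quadratic form in \<open>z\<close>.\<close>

lemma joined_conic:
  fixes F G :: "'m::{finite,linorder} flag"
  assumes F: "F \<in> IF12" and G: "G \<in> IF12" and disj: "snd F \<inter> snd G = {0}"
    and x: "x \<noteq> 0" "fst F = vec.span {x}" "x \<in> snd F"
    and y: "y \<noteq> 0" "fst G = vec.span {y}" "y \<in> snd G"
    and xy: "omega x y \<noteq> 0"
  shows "joined (1, 2) F G"
proof -
  obtain u where u: "wedge x u \<noteq> 0" "omega x u = 0" "snd F = vec.span {x, u}" "u \<in> snd F"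
    using IF12_adapted_basis[OF F x(3,1)] .
  obtain v' where v': "wedge y v' \<noteq> 0" "omega y v' = 0" "snd G = vec.span {y, v'}" "v' \<in> snd G"
    using IF12_adapted_basis[OF G y(3,1)] .
  text \<open>
    Shifting by a multiple of \<open>y\<close> makes the mixed term vanish, so that the planes of the
    curve below are isotropic.
  \<close>
  define v where "v = v' + (- (omega x v' + omega y u) / omega x y) *s y"
  have mixed: "omega x v + omega y u = 0" using xy by (simp add: v_def omega_simps)
  have v: "wedge y v \<noteq> 0" "omega y v = 0" "v \<in> snd G"
    using v' y(3) IF12_D(3)[OF G]
    by (simp_all add: v_def wedge_simps omega_simps vec.subspace_add vec.subspace_scale)
  have snd_G: "snd G = vec.span {y, v}" by (rule plane_eq_span[OF IF12_D(3,4)[OF G] y(3) v(3,1)])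
  let ?p = "pencil 1 x y" and ?q = "pencil 1 u v"
  have xy_span: "vec.span {x} \<noteq> vec.span {y}"
  proof
    assume "vec.span {x} = vec.span {y}"
    then have "x \<in> snd G" using vec.span_base[of x "{x}"] y(2) IF12_D(6)[OF G] by auto
    with x disj show False by auto
  qed
  have nz: "wedge (?p z) (?q z) \<noteq> 0" if z: "z \<noteq> 0" for z
  proof
    assume "wedge (?p z) (?q z) = 0"
    moreover have "?p z \<noteq> 0" by (rule pencil_nonzero[OF x(1) y(1) xy_span z])
    ultimately obtain k where k: "?q z = k *s ?p z"
      by (auto simp: wedge_eq_0_iff vec.span_singleton)
    \<comment> \<open>Sorting \<open>?q z = k *s ?p z\<close> by plane gives
      \<open>?a = - ?b\<close> with \<open>?a\<close> in \<open>snd F\<close> and \<open>?b\<close>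
      in \<open>snd G\<close>, so both vanish as the planes meet only in 0.\<close>
    let ?a = "z $ 1 *s (u - k *s x)" and ?b = "z $ 2 *s (v - k *s y)"
    have sum0: "?a + ?b = 0" using k by (simp add: pencil_def vec_eq_iff algebra_simps)
    have "?a \<in> snd F" "?b \<in> snd G"
      using IF12_D(3)[OF F] IF12_D(3)[OF G] x(3) y(3) u(4) v(3)
      by (auto intro: vec.subspace_scale vec.subspace_diff)
    moreover have "?a = (- 1) *s ?b" using sum0 by (simp add: add_eq_0_iff2)
    ultimately have "?a \<in> snd F \<inter> snd G"
      using IF12_D(3)[OF G] by (metis IntI vec.subspace_scale)
    then have "?a = 0" "?b = 0" using disj sum0 by auto
    moreover have "u - k *s x \<noteq> 0" "v - k *s y \<noteq> 0"
      using u(1) v(1) by (auto simp: wedge_scale_right)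
    ultimately have "z $ 1 = 0 \<and> z $ 2 = 0" unfolding vec.scale_eq_0_iff by blast
    with z nonzero_2_iff show False by blast
  qed
  have isotropic: "omega (?p z) (?q z) = 0" for z
  proof -
    have "omega (?p z) (?q z) = z $ 1 * z $ 2 * (omega x v + omega y u)"
      by (simp add: pencil_def omega_simps u(2) v(2) algebra_simps)
    then show ?thesis by (simp add: mixed)
  qed
  let ?F = "\<lambda>z. (vec.span {?p z}, vec.span {?p z, ?q z})"
  \<comment> \<open>The coefficients of the expanded wedge, indexed by the power of
    \<open>z $ 1\<close>.\<close>
  define e where "e = (\<lambda>i::nat. if i = 0 then wedge y v else if i = 1
    then wedge x v + wedge y u else wedge x u)"
  have e: "wedge (?p z) (?q z) = binary_form 2 e z" for z
    by (simp add: pencil_def wedge_simps binary_form_def e_def numeral_2_eq_2 vec_eq_iff algebra_simps)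
  have "?F z \<in> IF12" if "z \<noteq> 0" for z
    by (rule span_flag_in_IF12[OF nz[OF that] isotropic])
  moreover have "?F (k *s z) = ?F z" if "k \<noteq> 0" for k z
    using that by (simp add: pencil_scale span_scale_generator span_scale_generators)
  moreover have "?F (axis 1 1) = F" "?F (axis 2 1) = G"
    using x(2) y(2) u(3) snd_G by (simp_all add: pencil_axis prod_eq_iff)
  moreover have "F \<noteq> G" using disj IF12_snd_nonzero[OF F] by auto
  ultimately show ?thesis
    using joined_curve(1)[of ?F 1 "pencil_coeff 1 x y" 2 e "axis 1 1" "axis 2 1"] axis_2_nonzero e
    by (simp add: binary_form_pencil pluecker_span)
qed

lemma joined_all:
  fixes F G :: "'m::{finite,linorder} flag"
  assumes F: "F \<in> IF12" and G: "G \<in> IF12" and d: "d1 \<ge> 1" "d2 \<ge> 2" and card: "CARD('m) > 3"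
  shows "joined (d1, d2) F G"
proof -
  have "joined (1, 2) F G"
  proof (cases "snd F \<inter> snd G = {0}")
    case False
    then have "joined (1, 1) F G" using joined_meeting_planes[OF F G _ _ card] by simp
    then show ?thesis by (rule joined_increase_degree[OF _ G _ _ card]) auto
  next
    case True
    obtain x where x: "x \<noteq> 0" "fst F = vec.span {x}" "x \<in> snd F" using IF12_line[OF F] .
    obtain y where y: "y \<noteq> 0" "fst G = vec.span {y}" "y \<in> snd G" using IF12_line[OF G] .
    show ?thesis
    proof (cases "omega x y = 0")
      case False
      show ?thesis by (rule joined_conic[OF F G True x y False])
    next
      case xy: True
      have "wedge x y \<noteq> 0"
      \<comment> \<open>Proportional \<open>x\<close> and \<open>y\<close> would put
        \<open>x\<close> into both planes, which meet only in 0.\<close>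
      proof
        assume "wedge x y = 0"
        then have "fst F = fst G" using span_singleton_eq x y by simp
        then have "x \<in> snd G" using vec.span_base[of x "{x}"] x(2) IF12_D(6)[OF G] by auto
        with True x show False by auto
      qed
      then have "wedge y x \<noteq> 0" "omega y x = 0"
        using xy by (simp_all add: wedge_commute[of y] omega_skew[of y x])
      with \<open>wedge x y \<noteq> 0\<close> xy
      have H: "(vec.span {x}, vec.span {x, y}) \<in> IF12" "(vec.span {y}, vec.span {x, y}) \<in> IF12"
        using span_flag_in_IF12[of x y] span_flag_in_IF12[of y x] by (simp_all add: insert_commute)
      \<comment> \<open>Turn the plane about \<open>x\<close>, move the line inside
        \<open>span {x, y}\<close>, then turn the plane about \<open>y\<close>: the degrees add up
        to \<open>(1, 2)\<close>.\<close>
      have "joined (0, 1) F (vec.span {x}, vec.span {x, y})"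
        using joined_same_line[OF F H(1) _ _ card] x(2) by simp
      moreover have "joined (1, 0) (vec.span {x}, vec.span {x, y}) (vec.span {y}, vec.span {x, y})"
        using joined_same_plane[OF H] by simp
      moreover have "joined (0, 1) (vec.span {y}, vec.span {x, y}) G"
        using joined_same_line[OF H(2) G _ _ card] y(2) by simp
      ultimately show ?thesis
        using joined_trans[of 0 1 F "(vec.span {x}, vec.span {x, y})" 1 0]
          joined_trans[of 1 1 F "(vec.span {y}, vec.span {x, y})" 0 1 G]
        by (simp add: numeral_2_eq_2)
    qed
  qed
  then show ?thesis by (rule joined_increase_degree[OF _ G d card])
qed


section \<open>Curve neighborhoods\<close>

lemma joined_in_IF12:
  assumes "joined d F G"
  shows "F \<in> IF12" "G \<in> IF12"
proof -
  obtain M where M: "M \<in> Mbar d" "ev 1 M = F" "ev 2 M = G" using assms unfolding joined_def by blast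
  show "F \<in> IF12" "G \<in> IF12" using ev_in_IF12[OF M(1), of 1] ev_in_IF12[OF M(1), of 2] M(2,3) by auto
qed

section \<open>Incidence conditions describing the relation in each degree\<close>

lemma joined_same_line_iff:
  fixes F G :: "'m::{finite,linorder} flag"
  assumes "d > 0" "CARD('m) > 3"
  shows "joined (0, d) F G \<longleftrightarrow> F \<in> IF12 \<and> G \<in> IF12 \<and> fst F = fst G"
  using joined_in_IF12 joined_same_line[OF _ _ _ assms] Mbar_fst_const
  by (metis joined_def)

lemma joined_same_plane_iff:
  fixes F G :: "'m::{finite,linorder} flag"
  assumes "d > 0"
  shows "joined (d, 0) F G \<longleftrightarrow> F \<in> IF12 \<and> G \<in> IF12 \<and> snd F = snd G"
  using joined_in_IF12 joined_same_plane[OF _ _ _ assms] Mbar_snd_const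
  by (metis joined_def)

lemma joined_meeting_planes_iff:
  fixes F G :: "'m::{finite,linorder} flag"
  assumes "d > 0" "CARD('m) > 3"
  shows "joined (d, 1) F G \<longleftrightarrow> F \<in> IF12 \<and> G \<in> IF12 \<and> snd F \<inter> snd G \<noteq> {0}"
  using joined_in_IF12 joined_meeting_planes[OF _ _ _ assms] Mbar_snd_meet
  by (metis joined_def)

lemma joined_all_iff:
  fixes F G :: "'m::{finite,linorder} flag"
  assumes "d1 \<ge> 1" "d2 \<ge> 2" "CARD('m) > 3"
  shows "joined (d1, d2) F G \<longleftrightarrow> F \<in> IF12 \<and> G \<in> IF12"
  using joined_in_IF12 joined_all[OF _ _ assms] by metis

lemma curve_nbhd_joined:
  assumes "d \<noteq> (0, 0)"
  shows "curve_nbhd d \<Omega> = {G. \<exists>F\<in>\<Omega>. joined d F G}"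
  unfolding curve_nbhd_def joined_def if_not_P[OF assms] by blast

text \<open>The incidence conditions for \<open>joined\<close> see only whether \<open>d1\<close> is
  0 and, if it is positive, whether \<open>d2\<close> is 0, 1 or larger. With \<open>d1 = 0\<close>
  all positive \<open>d2\<close> agree, because the line is fixed.\<close>

lemma curve_nbhds_eq:
  fixes \<Omega> :: "'m::{finite,linorder} flag set"
  assumes card: "CARD('m) > 3"
  shows "{curve_nbhd (d1, d2) \<Omega> | d1 d2. True} =
    {\<Omega>, curve_nbhd (1, 0) \<Omega>, curve_nbhd (0, 1) \<Omega>, curve_nbhd (1, 1) \<Omega>, curve_nbhd (1, 2) \<Omega>}"
    (is "?L = ?R")
proof
  have "curve_nbhd (d1, d2) \<Omega> \<in> ?R" for d1 d2
  proof -
    consider "d1 = 0" "d2 = 0" | "d1 = 0" "d2 > 0" | "d1 > 0" "d2 = 0" | "d1 > 0" "d2 = 1"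
      | "d1 \<ge> 1" "d2 \<ge> 2"
      by linarith
    then show ?thesis
    proof cases
      case 1
      then show ?thesis by (simp add: curve_nbhd_def)
    next
      case 2
      then have "curve_nbhd (d1, d2) \<Omega> = curve_nbhd (0, 1) \<Omega>"
        using card by (simp add: curve_nbhd_joined joined_same_line_iff)
      then show ?thesis by simp
    next
      case 3
      then have "curve_nbhd (d1, d2) \<Omega> = curve_nbhd (1, 0) \<Omega>"
        by (simp add: curve_nbhd_joined joined_same_plane_iff)
      then show ?thesis by simp
    next
      case 4
      then have "curve_nbhd (d1, d2) \<Omega> = curve_nbhd (1, 1) \<Omega>"
        using joined_meeting_planes_iff[OF _ card] by (simp add: curve_nbhd_joined)
      then show ?thesis by simp
    next
      case 5
      then have "curve_nbhd (d1, d2) \<Omega> = curve_nbhd (1, 2) \<Omega>"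
        using joined_all_iff[OF _ _ card] by (simp add: curve_nbhd_joined)
      then show ?thesis by simp
    qed
  qed
  then show "?L \<subseteq> ?R" by blast
  have "\<Omega> = curve_nbhd (0, 0) \<Omega>" by (simp add: curve_nbhd_def)
  then show "?R \<subseteq> ?L" by blast
qed

text \<open>The inclusions are implications between incidence conditions: equal planes meet, and
  planes with a common line meet.\<close>

lemma curve_nbhd_inclusions:
  fixes \<Omega> :: "'m::{finite,linorder} flag set"
  assumes \<Omega>: "\<Omega> \<subseteq> IF12" and card: "CARD('m) > 3"
  shows "\<Omega> \<subseteq> curve_nbhd (1, 0) \<Omega>" "\<Omega> \<subseteq> curve_nbhd (0, 1) \<Omega>"
    "curve_nbhd (1, 0) \<Omega> \<subseteq> curve_nbhd (1, 1) \<Omega>" "curve_nbhd (0, 1) \<Omega> \<subseteq> curve_nbhd (1, 1) \<Omega>"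
    "curve_nbhd (1, 1) \<Omega> \<subseteq> curve_nbhd (1, 2) \<Omega>"
proof -
  have meet: "snd F \<inter> snd G \<noteq> {0}" if FG: "F \<in> IF12" "G \<in> IF12" "fst F = fst G" for F G :: "'m flag"
  proof -
    obtain x where "x \<noteq> 0" "fst F = vec.span {x}" "x \<in> snd F" using IF12_line[OF FG(1)] .
    moreover from this have "x \<in> snd G"
      using FG(3) IF12_D(6)[OF FG(2)] vec.span_base[of x "{x}"] by auto
    ultimately show ?thesis by blast
  qed
  have nbhd: "curve_nbhd (1, 0) \<Omega> = {G. \<exists>F\<in>\<Omega>. joined (1, 0) F G}"
    "curve_nbhd (0, 1) \<Omega> = {G. \<exists>F\<in>\<Omega>. joined (0, 1) F G}"
    "curve_nbhd (1, 1) \<Omega> = {G. \<exists>F\<in>\<Omega>. joined (1, 1) F G}"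
    "curve_nbhd (1, 2) \<Omega> = {G. \<exists>F\<in>\<Omega>. joined (1, 2) F G}"
    by (simp_all add: curve_nbhd_joined)
  have iff: "joined (1, 0) F G \<longleftrightarrow> F \<in> IF12 \<and> G \<in> IF12 \<and> snd F = snd G"
    "joined (0, 1) F G \<longleftrightarrow> F \<in> IF12 \<and> G \<in> IF12 \<and> fst F = fst G"
    "joined (1, 1) F G \<longleftrightarrow> F \<in> IF12 \<and> G \<in> IF12 \<and> snd F \<inter> snd G \<noteq> {0}"
    "joined (1, 2) F G \<longleftrightarrow> F \<in> IF12 \<and> G \<in> IF12" for F G :: "'m flag"
    by (rule joined_same_plane_iff joined_same_line_iff joined_meeting_planes_iff joined_all_iff;
        use card in simp)+
  show "\<Omega> \<subseteq> curve_nbhd (1, 0) \<Omega>" "\<Omega> \<subseteq> curve_nbhd (0, 1) \<Omega>"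
    "curve_nbhd (1, 0) \<Omega> \<subseteq> curve_nbhd (1, 1) \<Omega>" "curve_nbhd (0, 1) \<Omega> \<subseteq> curve_nbhd (1, 1) \<Omega>"
    "curve_nbhd (1, 1) \<Omega> \<subseteq> curve_nbhd (1, 2) \<Omega>"
    unfolding nbhd iff using \<Omega> meet IF12_snd_nonzero by fastforce+
qed

section \<open>Schubert varieties\<close>

lemma coord_flag_in_IF12:
  assumes "(a, b) \<in> W_odd"
  shows "coord_flag a b \<in> IF12"
proof -
  have ab: "a \<noteq> b" "\<not> opposite a b" "\<not> opposite b a"
    using assms by (auto simp: W_odd_def opposite_def)
  have "wedge (basis_vec a) (basis_vec b) $ (a, b) = 1"
    using ab(1) by (simp add: wedge_def basis_vec_def axis_def)
  then have "wedge (basis_vec a) (basis_vec b) \<noteq> 0" by auto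
  moreover have "omega (basis_vec a) (basis_vec b) = 0"
    \<comment> \<open>A summand can be nonzero only if its opposite pair consists of
      \<open>a\<close> and \<open>b\<close>, which is excluded.\<close>
    unfolding omega_def using ab by (intro sum.neutral) (auto simp: basis_vec_def axis_def)
  ultimately show ?thesis unfolding coord_flag_def by (rule span_flag_in_IF12)
qed

text \<open>An injective map preserving \<open>omega\<close> carries an adapted basis of the flag to
  an adapted basis of its image.\<close>

lemma act_in_IF12:
  assumes F: "F \<in> IF12" and g: "g \<in> Sp"
  shows "act g F \<in> IF12"
proof -
  have inj: "inj ((*v) g)" using g by (auto simp: Sp_def inj_matrix_vector_mult)
  obtain x where x: "x \<noteq> 0" "fst F = vec.span {x}" "x \<in> snd F" using IF12_line[OF F] .
  obtain u where u: "wedge x u \<noteq> 0" "omega x u = 0" "snd F = vec.span {x, u}"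
    using IF12_adapted_basis[OF F x(3,1)] by blast
  have "wedge (g *v x) (g *v u) \<noteq> 0"
  proof
    assume "wedge (g *v x) (g *v u) = 0"
    moreover have "g *v x \<noteq> 0" using inj x(1) by (metis injD matrix_vector_mult_0_right)
    ultimately obtain k where "g *v u = g *v (k *s x)"
      by (auto simp: wedge_eq_0_iff vec.span_singleton vec.scale)
    then have "u = k *s x" using inj by (simp add: inj_eq)
    with u(1) show False by (simp add: wedge_scale_right)
  qed
  moreover have "omega (g *v x) (g *v u) = 0" using g u(2) by (simp add: Sp_def)
  moreover have "act g F = (vec.span {g *v x}, vec.span {g *v x, g *v u})"
    unfolding act_def x(2) u(3) vec.span_image[symmetric] by simp
  ultimately show ?thesis using span_flag_in_IF12 by simp
qed

text \<open>\<open>IF12\<close> is itself closed, cut out by the empty family of equations, and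
  contains the orbit.\<close>

lemma Schubert_subset_IF12:
  assumes "(a, b) \<in> W_odd"
  shows "Schubert a b \<subseteq> IF12"
  unfolding Schubert_def
proof (rule hull_minimal)
  show "B_orbit (coord_flag a b) \<subseteq> IF12"
    using act_in_IF12[OF coord_flag_in_IF12[OF assms]] by (auto simp: B_orbit_def Borel_def)
  show "zariski_closed IF12"
    unfolding zariski_closed_def by (intro exI[of _ "{}"]) auto
qed

section \<open>The lattice\<close>

text \<open>The join and meet of the order are defined by choice; uniqueness of bounds identifies
  them with explicit \<open>J\<close> and \<open>K\<close>. These are parameters because the join in
  \<open>L\<close> need not be the union.\<close>

lemma distributive_lattice_inclusion_orderI:
  fixes L :: "'a set set"
  assumes closed: "\<And>x y. x \<in> L \<Longrightarrow> y \<in> L \<Longrightarrow> J x y \<in> L" "\<And>x y. x \<in> L \<Longrightarrow> y \<in> L \<Longrightarrow> K x y \<in> L"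
    and lub: "\<And>x y z. x \<in> L \<Longrightarrow> y \<in> L \<Longrightarrow> z \<in> L \<Longrightarrow> J x y \<subseteq> z \<longleftrightarrow> x \<subseteq> z \<and> y \<subseteq> z"
    and glb: "\<And>x y z. x \<in> L \<Longrightarrow> y \<in> L \<Longrightarrow> z \<in> L \<Longrightarrow> z \<subseteq> K x y \<longleftrightarrow> z \<subseteq> x \<and> z \<subseteq> y"
    and distrib: "\<And>x y z. x \<in> L \<Longrightarrow> y \<in> L \<Longrightarrow> z \<in> L \<Longrightarrow> J x (K y z) = K (J x y) (J x z)"
  shows "distributive_lattice (inclusion_order L)"
proof -
  let ?L = "inclusion_order L"
  have simps: "carrier ?L = L" "x \<sqsubseteq>\<^bsub>?L\<^esub> y \<longleftrightarrow> x \<subseteq> y" "x .=\<^bsub>?L\<^esub> y \<longleftrightarrow> x = y" for x y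
    by (simp_all add: inclusion_order_def)
  interpret partial_order ?L
    by unfold_locales (auto simp: simps fun_eq_iff)
  have least: "least ?L (J x y) (Upper ?L {x, y})" if "x \<in> L" "y \<in> L" for x y
    using closed(1) lub lub[of x y "J x y"] that unfolding least_def Upper_def simps by auto
  have greatest: "greatest ?L (K x y) (Lower ?L {x, y})" if "x \<in> L" "y \<in> L" for x y
    using closed(2) glb glb[of x y "K x y"] that unfolding greatest_def Lower_def simps by auto
  have join: "x \<squnion>\<^bsub>?L\<^esub> y = J x y" if "x \<in> L" "y \<in> L" for x y
    unfolding join_def sup_def 
    by (rule some_equality[where P = "\<lambda>z. least _ z _", OF least[OF that]]) (rule least_unique[OF _ least[OF that]])
  have meet: "x \<sqinter>\<^bsub>?L\<^esub> y = K x y" if "x \<in> L" "y \<in> L" for x y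
    unfolding meet_def inf_def 
    by (rule some_equality[where P = "\<lambda>z. greatest _ z _", OF greatest[OF that]])
      (rule greatest_unique[OF _ greatest[OF that]])
  have "Lattice.lattice ?L"
    by unfold_locales (unfold simps, (blast intro: least greatest)+)
  then show ?thesis
    unfolding distributive_lattice_def using distrib closed by (simp add: simps join meet)
qed

lemma distributive_lattice_of_square:
  assumes "A \<subseteq> B" "A \<subseteq> C" "B \<subseteq> D" "C \<subseteq> D" "D \<subseteq> E"
  shows "distributive_lattice (inclusion_order {A, B, C, D, E})"
proof (cases "B \<subseteq> C \<or> C \<subseteq> B")
  \<comment> \<open>The five sets form a chain, so union and intersection stay inside it and
    distributivity is that of sets.\<close>
  case True
  let ?L = "{A, B, C, D, E}"
  have chain: "x \<subseteq> y \<or> y \<subseteq> x" if "x \<in> ?L" "y \<in> ?L" for x y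
    using that assms True by blast
  have closed: "x \<union> y \<in> ?L" "x \<inter> y \<in> ?L" if "x \<in> ?L" "y \<in> ?L" for x y
    using chain[OF that] that by (metis Un_absorb1 Un_absorb2 Int_absorb1 Int_absorb2)+
  show ?thesis
    by (rule distributive_lattice_inclusion_orderI[where J = "(\<union>)" and K = "(\<inter>)"])
      (rule closed Un_subset_iff Int_subset_iff Un_Int_distrib; assumption)+
next
  case False
  \<comment> \<open>Now \<open>B\<close> and \<open>C\<close> are the only incomparable pair. Their
    join is \<open>D\<close> and their meet is \<open>A\<close>, even if \<open>D\<close> is larger
    than the union or \<open>A\<close> smaller than the intersection.\<close>
  define J where "J x y = (if x \<subseteq> y then y else if y \<subseteq> x then x else D)" for x y
  define K where "K x y = (if x \<subseteq> y then x else if y \<subseteq> x then y else A)" for x y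
  have not_le: "\<not> B \<subseteq> C" "\<not> C \<subseteq> B" "\<not> B \<subseteq> A" "\<not> C \<subseteq> A" "\<not> D \<subseteq> A" "\<not> D \<subseteq> B" "\<not> D \<subseteq> C"
    "\<not> E \<subseteq> A" "\<not> E \<subseteq> B" "\<not> E \<subseteq> C"
    using False assms by blast+
  have le: "A \<subseteq> B" "A \<subseteq> C" "B \<subseteq> D" "C \<subseteq> D" "D \<subseteq> E" "A \<subseteq> D" "A \<subseteq> E" "B \<subseteq> E" "C \<subseteq> E"
    using assms by blast+
  \<comment> \<open>The two largest sets may coincide, so \<open>E \<subseteq> D\<close> is not
    refuted like the other reversed inclusions.\<close>
  have top: "E \<subseteq> D \<longleftrightarrow> E = D" using assms by blast
  show ?thesis
  proof (rule distributive_lattice_inclusion_orderI[where J = J and K = K])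
    fix x y assume xy: "x \<in> {A, B, C, D, E}" "y \<in> {A, B, C, D, E}"
    then show "J x y \<in> {A, B, C, D, E}" "K x y \<in> {A, B, C, D, E}" by (auto simp: J_def K_def)
    fix z assume z: "z \<in> {A, B, C, D, E}"
    from xy z show "J x y \<subseteq> z \<longleftrightarrow> x \<subseteq> z \<and> y \<subseteq> z"
      by (elim insertE emptyE; simp add: J_def le not_le top; blast?)
    from xy z show "z \<subseteq> K x y \<longleftrightarrow> z \<subseteq> x \<and> z \<subseteq> y"
      by (elim insertE emptyE; simp add: K_def le not_le top; blast?)
    from xy z show "J x (K y z) = K (J x y) (J x z)"
      by (elim insertE emptyE; simp add: J_def K_def le not_le top)
  qed
qed

theorem theorem5p3:
  fixes n :: nat and a b :: "'m::{finite,linorder}"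
  assumes "n \<ge> 2" and "CARD('m) = 2 * n + 1" and "(a, b) \<in> W_odd"
  shows "distributive_lattice
           (inclusion_order {curve_nbhd (d1, d2) (Schubert a b) | d1 d2. True})"
proof -
  have "CARD('m) > 3" using assms(1,2) by simp
  then show ?thesis
    unfolding curve_nbhds_eq[OF \<open>CARD('m) > 3\<close>]
    by (intro distributive_lattice_of_square curve_nbhd_inclusions Schubert_subset_IF12 assms(3))
qed

end
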